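(* Let $E$ be a Dedekind complete real Banach lattice such that its centre $\mathcal Z(E)$ is normal. Take $T\in\mathcal Z(E_{\mathbb C})$, and suppose that $\sigma(T)$ is a countable infinite set $\{\lambda_1,\lambda_2,\dots\}$ (with the $\lambda_i$ distinct). Let $P_{\lambda_i}=\mu_T(\{\lambda_i\})$, where $\mu_T$ is the spectral measure of $T$. Then: (1) $I=\sigma o\text{-}\sum_{i=1}^\infty P_{\lambda_i}$ and $T=\sigma o\text{-}\sum_{i=1}^\infty\lambda_iP_{\lambda_i}$ in $\mathcal Z(E_{\mathbb C})$; (2) for every $z\in E_{\mathbb C}$, there exist unique $z_i\in E_{\mathbb C}$ ($i\ge1$) such that $(T-\lambda_iI)z_i=0$ for all $i$ and $z=\sigma o\text{-}\sum_{i=1}^\infty z_i$ in $E_{\mathbb C}$. In fact, $z_i=P_{\lambda_i}z$.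
   Context: Operators are linear; $I$ is the identity operator. For a Dedekind complete real Banach lattice $E$, the complexification $E_{\mathbb C}=E+iE$ carries the modulus $|x+iy|=\sup_{\theta}(x\cos\theta+y\sin\theta)$ and the norm $\lVert z\rVert=\lVert\,|z|\,\rVert$. $L_r(E)$ is the Dedekind complete vector lattice of regular operators on $E$, $L_r(E_{\mathbb C})=L_r(E)+iL_r(E)$, and for $T=R+iS$ with $R,S\in L_r(E)$, $|T|=\sup_\theta(R\cos\theta+S\sin\theta)$. The centres are $\mathcal Z(E)=\{T\in L_r(E):|T|\le\lambda I\text{ for some }\lambda\ge0\}$ (a Dedekind complete vector lattice and an algebra under composition) and $\mathcal Z(E_{\mathbb C})=\{T\in L_r(E_{\mathbb C}):|T|\le\lambda I\text{ for some }\lambda\ge0\}=\mathcal Z(E)+i\mathcal Z(E)$. $\sigma(T)$ is the spectrum of $T$ as a bounded operator on $E_{\mathbb C}$, which coincides with its spectrum in $\mathcal Z(E_{\mathbb C})$. A real vector lattice is normal when its order continuous dual separates its points. $\mathcal B(\cdot)$ denotes the Borel $\sigma$-algebra. In a complex vector lattice $F_{\mathbb C}$, a sequence $(z_n)$ is $\sigma$-order convergent to $z$ when there is a sequence $(u_n)$ in $F$ with $u_n\downarrow0$ and $|z_n-z|\le u_n$ for all $n$. One writes $z=\sigma o\text{-}\sum_{n=1}^\infty z_n$ when the partial sums $\sum_{n=1}^Nz_n$ are $\sigma$-order convergent to $z$. Measures and integrals: let $F=\mathcal Z(E)$. An $F$-valued measure on a $\sigma$-algebra $\Omega$ is a map $\mu\colon\Omega\to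 F^+$ with $\mu(\emptyset)=0$ and $\mu(\bigcup_n\Delta_n)=\sup_N\sum_{n=1}^N\mu(\Delta_n)$ for pairwise disjoint sequences $(\Delta_n)$; it is spectral when $\mu(\Delta_1\cap\Delta_2)=\mu(\Delta_1)\mu(\Delta_2)$ for all $\Delta_1,\Delta_2\in\Omega$. The order integral of $\varphi=\sum_{i=1}^n r_i\chi_{\Delta_i}$ with $r_i\ge0$, $\Delta_i\in\Omega$ is $\sum_i r_i\mu(\Delta_i)$; for bounded measurable $f\ge0$, $\int^o f\,d\mu=\sup_n\int^o\varphi_n\,d\mu$ for any sequence of such functions $\varphi_n\uparrow f$ pointwise (independent of the choice); this extends to bounded measurable real $f$ via $f^+$ and $f^-$ and to bounded measurable complex $f$ via real and imaginary parts, with values in $F_{\mathbb C}$. For $E$ with normal centre and $T\in\mathcal Z(E_{\mathbb C})$, the spectral measure of $T$ is the unique spectral measure $\mu_T\colon\mathcal B(\sigma(T))\to\mathcal Z(E)^+$ with $\mu_T(\sigma(T))=I$ and $T=\int^o_{\sigma(T)}\mathrm{id}\,d\mu_T$, where $\mathrm{id}$ is the identity function on $\sigma(T)$. *)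

theory Defs
  imports "HOL-Analysis.Analysis" "HOL-Library.Lattice_Algebras"
begin

section \<open>Dedekind complete vector lattices and Banach lattices\<close>

class dedekind_complete_vector_lattice =
  ordered_real_vector + lattice_ab_group_add_abs + conditionally_complete_lattice

class dedekind_complete_banach_lattice = dedekind_complete_vector_lattice + banach +
  assumes norm_mono_abs: "\<bar>x\<bar> \<le> \<bar>y\<bar> \<Longrightarrow> norm x \<le> norm y"

lemma pprt_plus_neg:
  fixes x :: "'a::dedekind_complete_vector_lattice"
  obtains p q where "0 \<le> p" "0 \<le> q" "x = p - q"
  using prts[of x] nprt_le_zero[of x] zero_le_pprt[of x]
  by (metis diff_minus_eq_add neg_0_le_iff_le)

lemma riesz_decomposition:
  fixes x y z :: "'a::dedekind_complete_vector_lattice"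
  assumes "0 \<le> x" "0 \<le> y" "0 \<le> z" "z \<le> x + y"
  obtains u v where "0 \<le> u" "u \<le> x" "0 \<le> v" "v \<le> y" "z = u + v"
proof
  show "0 \<le> inf z x" "inf z x \<le> x" using assms by auto
  have "z - y \<le> z" "z - y \<le> x" using assms by (auto simp: algebra_simps)
  then have "z - y \<le> inf z x" by (rule inf_greatest)
  then show "z - inf z x \<le> y" by (metis diff_le_eq add.commute)
  show "0 \<le> z - inf z x" by (metis diff_ge_0_iff_ge inf_le1)
  show "z = inf z x + (z - inf z x)" by (metis add.commute diff_add_cancel)
qed


section \<open>Regular operators\<close>

definition positive_operator :: "('a::dedekind_complete_vector_lattice \<Rightarrow> 'a) \<Rightarrow> bool" where
  "positive_operator P \<longleftrightarrow> linear P \<and> (\<forall>x\<ge>0. 0 \<le> P x)"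

typedef (overloaded) 'a::dedekind_complete_vector_lattice regular_operator =
  "{T :: 'a \<Rightarrow> 'a. \<exists>P Q. positive_operator P \<and> positive_operator Q \<and> T = (\<lambda>x. P x - Q x)}"
  morphisms rapply Abs_regular_operator
  by (rule exI[of _ "\<lambda>x. 0"])
    (auto simp: positive_operator_def intro!: exI[of _ "\<lambda>x. 0"] module_hom_zero)

setup_lifting type_definition_regular_operator

lemma positive_operator_add:
  "positive_operator P \<Longrightarrow> positive_operator Q \<Longrightarrow> positive_operator (\<lambda>x. P x + Q x)"
  by (auto simp: positive_operator_def linear_compose_add)

lemma positive_operator_scaleR:
  "positive_operator P \<Longrightarrow> 0 \<le> r \<Longrightarrow> positive_operator (\<lambda>x. r *\<^sub>R P x)"
  by (auto simp: positive_operator_def linear_compose_scale_right scaleR_nonneg_nonneg)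

lemma positive_operator_comp:
  "positive_operator P \<Longrightarrow> positive_operator Q \<Longrightarrow> positive_operator (\<lambda>x. P (Q x))"
  using linear_compose[of Q P] by (auto simp: positive_operator_def o_def)

lemma rapply_pos:
  obtains P Q where "positive_operator P" "positive_operator Q" "rapply T = (\<lambda>x. P x - Q x)"
  using rapply[of T] by auto

lemma linear_rapply: "linear (rapply T)"
  using rapply_pos[of T] by (metis positive_operator_def linear_compose_sub)

lemma rapply_eqI:
  assumes "\<And>x. 0 \<le> x \<Longrightarrow> rapply S x = rapply T x"
  shows "S = T"
proof -
  have "rapply S x = rapply T x" for x
  proof -
    obtain p q where "0 \<le> p" "0 \<le> q" "x = p - q" by (rule pprt_plus_neg)
    then show ?thesis using assms linear_rapply[of S] linear_rapply[of T]
      by (simp add: linear_diff)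
  qed
  then show ?thesis by (simp add: rapply_inject[symmetric] fun_eq_iff)
qed

instantiation regular_operator :: (dedekind_complete_vector_lattice) real_vector
begin

lift_definition zero_regular_operator :: "'a regular_operator" is "\<lambda>x. 0"
  by (auto simp: positive_operator_def intro!: exI[of _ "\<lambda>x. 0"] module_hom_zero)

lift_definition plus_regular_operator ::
  "'a regular_operator \<Rightarrow> 'a regular_operator \<Rightarrow> 'a regular_operator" is "\<lambda>S T x. S x + T x"
proof clarify
  fix P Q P' Q' :: "'a \<Rightarrow> 'a"
  assume "positive_operator P" "positive_operator Q" "positive_operator P'" "positive_operator Q'"
  then show "\<exists>A B. positive_operator A \<and> positive_operator B \<and>
      (\<lambda>x. P x - Q x + (P' x - Q' x)) = (\<lambda>x. A x - B x)"
    by (intro exI[of _ "\<lambda>x. P x + P' x"] exI[of _ "\<lambda>x. Q x + Q' x"])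
      (auto simp: positive_operator_add)
qed

lift_definition uminus_regular_operator :: "'a regular_operator \<Rightarrow> 'a regular_operator"
  is "\<lambda>T x. - T x"
  by (metis minus_diff_eq)

lift_definition minus_regular_operator ::
  "'a regular_operator \<Rightarrow> 'a regular_operator \<Rightarrow> 'a regular_operator" is "\<lambda>S T x. S x - T x"
proof clarify
  fix P Q P' Q' :: "'a \<Rightarrow> 'a"
  assume "positive_operator P" "positive_operator Q" "positive_operator P'" "positive_operator Q'"
  then show "\<exists>A B. positive_operator A \<and> positive_operator B \<and>
      (\<lambda>x. P x - Q x - (P' x - Q' x)) = (\<lambda>x. A x - B x)"
    by (intro exI[of _ "\<lambda>x. P x + Q' x"] exI[of _ "\<lambda>x. Q x + P' x"])
      (auto simp: positive_operator_add)
qed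

lift_definition scaleR_regular_operator :: "real \<Rightarrow> 'a regular_operator \<Rightarrow> 'a regular_operator"
  is "\<lambda>r T x. r *\<^sub>R T x"
proof clarify
  fix r :: real and P Q :: "'a \<Rightarrow> 'a"
  assume PQ: "positive_operator P" "positive_operator Q"
  show "\<exists>A B. positive_operator A \<and> positive_operator B \<and>
      (\<lambda>x. r *\<^sub>R (P x - Q x)) = (\<lambda>x. A x - B x)"
  proof (cases "0 \<le> r")
    case True
    then show ?thesis using PQ
      by (intro exI[of _ "\<lambda>x. r *\<^sub>R P x"] exI[of _ "\<lambda>x. r *\<^sub>R Q x"])
        (auto simp: positive_operator_scaleR scaleR_diff_right)
  next
    case False
    then show ?thesis using PQ
      by (intro exI[of _ "\<lambda>x. (-r) *\<^sub>R Q x"] exI[of _ "\<lambda>x. (-r) *\<^sub>R P x"])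
        (auto simp: positive_operator_scaleR scaleR_diff_right
          simp del: scaleR_minus_left intro!: positive_operator_scaleR; simp add: algebra_simps)
  qed
qed

instance
  by standard (transfer; simp add: fun_eq_iff algebra_simps)+

end

instantiation regular_operator :: (dedekind_complete_vector_lattice) "{real_algebra, monoid_mult}"
begin

lift_definition one_regular_operator :: "'a regular_operator" is "\<lambda>x. x"
  by (rule exI[of _ "\<lambda>x. x"], rule exI[of _ "\<lambda>x. 0"])
    (auto simp: positive_operator_def module_hom_zero linear_iff)

lift_definition times_regular_operator ::
  "'a regular_operator \<Rightarrow> 'a regular_operator \<Rightarrow> 'a regular_operator" is "\<lambda>S T x. S (T x)"
proof clarify
  fix P Q P' Q' :: "'a \<Rightarrow> 'a"
  assume *: "positive_operator P" "positive_operator Q" "positive_operator P'" "positive_operator Q'"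
  then have "linear P" "linear Q" by (auto simp: positive_operator_def)
  with * show "\<exists>A B. positive_operator A \<and> positive_operator B \<and>
      (\<lambda>x. P (P' x - Q' x) - Q (P' x - Q' x)) = (\<lambda>x. A x - B x)"
    by (intro exI[of _ "\<lambda>x. P (P' x) + Q (Q' x)"] exI[of _ "\<lambda>x. P (Q' x) + Q (P' x)"])
      (auto simp: positive_operator_add positive_operator_comp linear_diff)
qed

instance
proof
  fix a b c :: "'a regular_operator" and r :: real
  show "a * b * c = a * (b * c)" "1 * a = a" "a * 1 = a" "(a + b) * c = a * c + b * c"
    "r *\<^sub>R a * b = r *\<^sub>R (a * b)"
    by (transfer; simp)+
  show "a * (b + c) = a * b + a * c"
    using linear_rapply[of a]
    by (simp add: rapply_inject[symmetric] times_regular_operator.rep_eq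
        plus_regular_operator.rep_eq linear_add)
  show "a * r *\<^sub>R b = r *\<^sub>R (a * b)"
    using linear_rapply[of a]
    by (simp add: rapply_inject[symmetric] times_regular_operator.rep_eq
        scaleR_regular_operator.rep_eq linear_scale)
qed

end

lemmas rapply_simps [simp] =
  zero_regular_operator.rep_eq plus_regular_operator.rep_eq minus_regular_operator.rep_eq
  uminus_regular_operator.rep_eq scaleR_regular_operator.rep_eq one_regular_operator.rep_eq
  times_regular_operator.rep_eq

instantiation regular_operator :: (dedekind_complete_vector_lattice) ordered_real_vector
begin

definition less_eq_regular_operator :: "'a regular_operator \<Rightarrow> 'a regular_operator \<Rightarrow> bool" where
  "S \<le> T \<longleftrightarrow> (\<forall>x\<ge>0. rapply S x \<le> rapply T x)"

definition less_regular_operator :: "'a regular_operator \<Rightarrow> 'a regular_operator \<Rightarrow> bool" where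
  "(S :: 'a regular_operator) < T \<longleftrightarrow> S \<le> T \<and> \<not> T \<le> S"

instance
proof
  fix a b c :: "'a regular_operator" and r s :: real
  show "(a < b) = (a \<le> b \<and> \<not> b \<le> a)" by (rule less_regular_operator_def)
  show "a \<le> a" by (simp add: less_eq_regular_operator_def)
  show "a \<le> b \<Longrightarrow> b \<le> c \<Longrightarrow> a \<le> c"
    unfolding less_eq_regular_operator_def by (meson order_trans)
  show "a \<le> b \<Longrightarrow> b \<le> a \<Longrightarrow> a = b"
    unfolding less_eq_regular_operator_def by (rule rapply_eqI) (meson order_antisym)
  show "a \<le> b \<Longrightarrow> c + a \<le> c + b" by (simp add: less_eq_regular_operator_def)
  show "a \<le> b \<Longrightarrow> 0 \<le> r \<Longrightarrow> r *\<^sub>R a \<le> r *\<^sub>R b"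
    by (simp add: less_eq_regular_operator_def scaleR_left_mono)
  show "r \<le> s \<Longrightarrow> 0 \<le> a \<Longrightarrow> r *\<^sub>R a \<le> s *\<^sub>R a"
    by (simp add: less_eq_regular_operator_def scaleR_right_mono)
qed

end

text \<open>The Riesz--Kantorovich formula: the supremum of a set of regular operators is given at a
  positive vector by the supremum of the following set of sums over finite partitions.\<close>

definition rk_sums ::
  "'a::dedekind_complete_vector_lattice regular_operator set \<Rightarrow> 'a \<Rightarrow> 'a set" where
  "rk_sums A x = {(\<Sum>(S, y)\<leftarrow>ps. rapply S y) | ps.
     set ps \<subseteq> A \<times> {0..} \<and> (\<Sum>(S, y)\<leftarrow>ps. y) = x}"

lemma rk_sums_single: "S \<in> A \<Longrightarrow> 0 \<le> x \<Longrightarrow> rapply S x \<in> rk_sums A x"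
  unfolding rk_sums_def by (auto intro!: exI[of _ "[(S, x)]"])

lemma rk_sums_add:
  "a \<in> rk_sums A x \<Longrightarrow> b \<in> rk_sums A y \<Longrightarrow> a + b \<in> rk_sums A (x + y)"
proof -
  assume "a \<in> rk_sums A x" "b \<in> rk_sums A y"
  then obtain ps qs where "set ps \<subseteq> A \<times> {0..}" "(\<Sum>(S, y)\<leftarrow>ps. y) = x"
    "(\<Sum>(S, y)\<leftarrow>ps. rapply S y) = a" "set qs \<subseteq> A \<times> {0..}" "(\<Sum>(S, y)\<leftarrow>qs. y) = y"
    "(\<Sum>(S, y)\<leftarrow>qs. rapply S y) = b"
    unfolding rk_sums_def by blast
  then show ?thesis unfolding rk_sums_def by (auto intro!: exI[of _ "ps @ qs"])
qed

lemma rk_sums_scaleR: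
  assumes "a \<in> rk_sums A x" "0 \<le> r" shows "r *\<^sub>R a \<in> rk_sums A (r *\<^sub>R x)"
proof -
  obtain ps where ps: "set ps \<subseteq> A \<times> {0..}" "(\<Sum>(S, y)\<leftarrow>ps. y) = x"
    "(\<Sum>(S, y)\<leftarrow>ps. rapply S y) = a"
    using assms unfolding rk_sums_def by blast
  have 1: "(\<Sum>(S, y)\<leftarrow>map (\<lambda>(S, y). (S, r *\<^sub>R y)) qs. y) = r *\<^sub>R (\<Sum>(S, y)\<leftarrow>qs. y)"
    for qs :: "('a regular_operator \<times> 'a) list"
    by (induction qs) (auto simp: algebra_simps)
  have 2: "(\<Sum>(S, y)\<leftarrow>map (\<lambda>(S, y). (S, r *\<^sub>R y)) qs. rapply S y) = r *\<^sub>R (\<Sum>(S, y)\<leftarrow>qs. rapply S y)"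
    for qs :: "('a regular_operator \<times> 'a) list"
    by (induction qs) (auto simp: algebra_simps linear_scale[OF linear_rapply])
  show ?thesis unfolding rk_sums_def using ps assms(2)
    by (intro CollectI exI[of _ "map (\<lambda>(S, y). (S, r *\<^sub>R y)) ps"])
      (use 1 2 in \<open>auto simp: scaleR_nonneg_nonneg simp del: map_map\<close>)
qed

lemma rk_sums_split:
  assumes "c \<in> rk_sums A (x + y)" "0 \<le> x" "0 \<le> y"
  obtains a b where "a \<in> rk_sums A x" "b \<in> rk_sums A y" "c = a + b"
proof -
  obtain ps where ps: "set ps \<subseteq> A \<times> {0..}" "(\<Sum>(S, y)\<leftarrow>ps. y) = x + y"
    "(\<Sum>(S, y)\<leftarrow>ps. rapply S y) = c"
    using assms unfolding rk_sums_def by blast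
  have "\<exists>a\<in>rk_sums A x. \<exists>b\<in>rk_sums A y. (\<Sum>(S, y)\<leftarrow>ps. rapply S y) = a + b"
    using ps(1,2) assms(2,3)
  proof (induction ps arbitrary: x y)
    case Nil
    then have "x = 0" "y = 0" by (auto simp: add_nonneg_eq_0_iff)
    moreover have "0 \<in> rk_sums A 0" unfolding rk_sums_def by (auto intro!: exI[of _ "[]"])
    ultimately show ?case by (auto intro!: bexI[of _ 0])
  next
    case (Cons p ps)
    obtain S z where p: "p = (S, z)" by (cases p)
    have S: "S \<in> A" "0 \<le> z" using Cons.prems p by auto
    have nn: "0 \<le> (\<Sum>(S, y)\<leftarrow>ps. y)" using Cons.prems(1) by (intro sum_list_nonneg) auto
    have zs: "z + (\<Sum>(S, y)\<leftarrow>ps. y) = x + y" using Cons.prems p by auto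
    then have "z \<le> x + y" using nn by (metis le_add_same_cancel1)
    then obtain u v where uv: "0 \<le> u" "u \<le> x" "0 \<le> v" "v \<le> y" "z = u + v"
      using riesz_decomposition Cons.prems S by metis
    have "(\<Sum>(S, y)\<leftarrow>ps. y) = (x - u) + (y - v)" using zs uv(5) by (simp add: algebra_simps)
    then obtain a b where ab: "a \<in> rk_sums A (x - u)" "b \<in> rk_sums A (y - v)"
      "(\<Sum>(S, y)\<leftarrow>ps. rapply S y) = a + b"
      using Cons.IH[of "x - u" "y - v"] Cons.prems uv by auto
    have "rapply S u + a \<in> rk_sums A x" "rapply S v + b \<in> rk_sums A y"
      using rk_sums_add[OF rk_sums_single[OF S(1) uv(1)] ab(1)]
        rk_sums_add[OF rk_sums_single[OF S(1) uv(3)] ab(2)] by auto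
    moreover have "(\<Sum>(S, y)\<leftarrow>p # ps. rapply S y) = (rapply S u + a) + (rapply S v + b)"
      using p uv ab by (simp add: linear_add[OF linear_rapply])
    ultimately show ?case by blast
  qed
  then show ?thesis using that ps by auto
qed

lemma rk_sums_le:
  assumes "a \<in> rk_sums A x" "\<And>S. S \<in> A \<Longrightarrow> S \<le> B" shows "a \<le> rapply B x"
proof -
  obtain ps where ps: "set ps \<subseteq> A \<times> {0..}" "(\<Sum>(S, y)\<leftarrow>ps. y) = x"
    "(\<Sum>(S, y)\<leftarrow>ps. rapply S y) = a"
    using assms unfolding rk_sums_def by blast
  have "(\<Sum>(S, y)\<leftarrow>ps. rapply S y) \<le> rapply B (\<Sum>(S, y)\<leftarrow>ps. y)" using ps(1)
  proof (induction ps)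
    case Nil
    then show ?case using linear_0[OF linear_rapply[of B]] by simp
  next
    case (Cons p ps)
    then show ?case using assms(2)
      by (auto simp: linear_add[OF linear_rapply] less_eq_regular_operator_def intro!: add_mono)
  qed
  then show ?thesis using ps by simp
qed

lemma regular_operator_lub_exists:
  fixes A :: "'a::dedekind_complete_vector_lattice regular_operator set"
  assumes "A \<noteq> {}" and B: "\<And>S. S \<in> A \<Longrightarrow> S \<le> B"
  shows "\<exists>L. (\<forall>S\<in>A. S \<le> L) \<and> (\<forall>U. (\<forall>S\<in>A. S \<le> U) \<longrightarrow> L \<le> U)"
proof -
  obtain S0 where S0: "S0 \<in> A" using assms by auto
  define g where "g x = Sup (rk_sums A x)" for x
  have ne: "rk_sums A x \<noteq> {}" if "0 \<le> x" for x using rk_sums_single[OF S0 that] by auto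
  have bdd: "bdd_above (rk_sums A x)" for x
    by (rule bdd_aboveI[of _ "rapply B x"]) (rule rk_sums_le[OF _ B])
  have g_ub: "a \<in> rk_sums A x \<Longrightarrow> a \<le> g x" for a x
    unfolding g_def using bdd by (rule cSup_upper[rotated])
  have g_least: "0 \<le> x \<Longrightarrow> (\<And>a. a \<in> rk_sums A x \<Longrightarrow> a \<le> u) \<Longrightarrow> g x \<le> u" for x u
    unfolding g_def by (rule cSup_least[OF ne])
  have g_add: "g (x + y) = g x + g y" if xy: "0 \<le> x" "0 \<le> y" for x y
  proof (rule antisym)
    show "g (x + y) \<le> g x + g y"
    proof (rule g_least)
      show "0 \<le> x + y" using xy by simp
      fix c assume "c \<in> rk_sums A (x + y)"
      then obtain a b where "a \<in> rk_sums A x" "b \<in> rk_sums A y" "c = a + b"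
        using rk_sums_split xy by metis
      then show "c \<le> g x + g y" using g_ub by (simp add: add_mono)
    qed
    have "a \<le> g (x + y) - g y" if a: "a \<in> rk_sums A x" for a
    proof -
      have "g y \<le> g (x + y) - a"
        by (rule g_least[OF xy(2)]) (use g_ub[OF rk_sums_add[OF a]] in \<open>simp add: le_diff_eq add.commute[of _ a]\<close>)
      then show ?thesis by (simp add: algebra_simps)
    qed
    from g_least[OF xy(1) this] show "g x + g y \<le> g (x + y)" by (simp add: algebra_simps)
  qed
  have g_scale_le: "r *\<^sub>R g x \<le> g (r *\<^sub>R x)" if "0 \<le> x" "0 < r" for r x
  proof -
    have "g x \<le> (1/r) *\<^sub>R g (r *\<^sub>R x)"
    proof (rule g_least[OF that(1)])
      fix a assume "a \<in> rk_sums A x"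
      then have "r *\<^sub>R a \<le> g (r *\<^sub>R x)" using that by (intro g_ub rk_sums_scaleR) auto
      then have "(1/r) *\<^sub>R r *\<^sub>R a \<le> (1/r) *\<^sub>R g (r *\<^sub>R x)"
        using that by (intro scaleR_left_mono) auto
      then show "a \<le> (1/r) *\<^sub>R g (r *\<^sub>R x)" using that by simp
    qed
    then have "r *\<^sub>R g x \<le> r *\<^sub>R (1/r) *\<^sub>R g (r *\<^sub>R x)" using that by (intro scaleR_left_mono) auto
    then show ?thesis using that by simp
  qed
  have g0: "g 0 = 0" using g_add[of 0 0] by simp
  have g_scale: "g (r *\<^sub>R x) = r *\<^sub>R g x" if "0 \<le> x" "0 \<le> r" for r x
  proof (cases "r = 0")
    case False
    then have r: "0 < r" using that by simp
    have "(1/r) *\<^sub>R g (r *\<^sub>R x) \<le> g x"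
      using g_scale_le[of "r *\<^sub>R x" "1/r"] r that by (simp add: scaleR_nonneg_nonneg)
    then have "r *\<^sub>R (1/r) *\<^sub>R g (r *\<^sub>R x) \<le> r *\<^sub>R g x" using that by (intro scaleR_left_mono) auto
    then show ?thesis using g_scale_le[OF that(1) r] r by (intro antisym) auto
  qed (simp add: g0)
  define f where "f x = g (pprt x) - g (- nprt x)" for x
  have f_diff: "f (p - q) = g p - g q" if "0 \<le> p" "0 \<le> q" for p q
  proof -
    have "pprt (p - q) + q = p + (- nprt (p - q))" using prts[of "p - q"] by (simp add: algebra_simps)
    then have "g (pprt (p - q)) + g q = g p + g (- nprt (p - q))"
      using that g_add by (metis neg_0_le_iff_le nprt_le_zero zero_le_pprt)
    then show ?thesis unfolding f_def by (simp add: algebra_simps)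
  qed
  have f_pos: "f x = g x" if "0 \<le> x" for x using f_diff[of x 0] that g0 by simp
  have "linear f"
  proof (rule linearI)
    fix x y :: 'a
    obtain p q where x: "0 \<le> p" "0 \<le> q" "x = p - q" by (rule pprt_plus_neg)
    obtain p' q' where y: "0 \<le> p'" "0 \<le> q'" "y = p' - q'" by (rule pprt_plus_neg)
    have e: "x + y = (p + p') - (q + q')" using x y by simp
    have "f (x + y) = g p + g p' - (g q + g q')"
      using f_diff[OF add_nonneg_nonneg[OF x(1) y(1)] add_nonneg_nonneg[OF x(2) y(2)]]
      by (simp only: e g_add[OF x(1) y(1)] g_add[OF x(2) y(2)])
    moreover have "f x = g p - g q" "f y = g p' - g q'" using f_diff[OF x(1,2)] f_diff[OF y(1,2)] x(3) y(3) by metis+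
    ultimately show "f (x + y) = f x + f y" by simp
    fix r :: real
    show "f (r *\<^sub>R x) = r *\<^sub>R f x"
    proof (cases "0 \<le> r")
      case True
      then show ?thesis using f_diff[of "r *\<^sub>R p" "r *\<^sub>R q"] f_diff[of p q] x g_scale
        by (simp add: scaleR_nonneg_nonneg scaleR_diff_right)
    next
      case False
      have "r *\<^sub>R x = (-r) *\<^sub>R q - (-r) *\<^sub>R p" using x by (simp add: scaleR_diff_right)
      moreover have "0 \<le> (-r) *\<^sub>R q" "0 \<le> (-r) *\<^sub>R p"
        using x False by (intro scaleR_nonneg_nonneg; simp)+
      ultimately have "f (r *\<^sub>R x) = g ((-r) *\<^sub>R q) - g ((-r) *\<^sub>R p)" using f_diff by metis
      also have "\<dots> = (-r) *\<^sub>R g q - (-r) *\<^sub>R g p" using g_scale[of q "-r"] g_scale[of p "-r"] x False by simp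
      finally show ?thesis using f_diff[of p q] x by (simp add: scaleR_diff_right)
    qed
  qed
  moreover obtain P Q where PQ: "positive_operator P" "positive_operator Q"
    "rapply S0 = (\<lambda>x. P x - Q x)" by (rule rapply_pos)
  ultimately have "positive_operator (\<lambda>x. (f x - rapply S0 x) + P x)"
  proof (intro positive_operator_add)
    assume "linear f"
    then show "positive_operator (\<lambda>x. f x - rapply S0 x)"
      using linear_compose_sub[OF _ linear_rapply] f_pos g_ub rk_sums_single[OF S0]
      by (auto simp: positive_operator_def)
  qed
  moreover have "f = (\<lambda>x. ((f x - rapply S0 x) + P x) - Q x)" using PQ(3) by auto
  ultimately have rep: "rapply (Abs_regular_operator f) = f"
    using PQ(2) by (intro Abs_regular_operator_inverse) blast
  show ?thesis
  proof (intro exI[of _ "Abs_regular_operator f"] conjI ballI allI impI)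
    show "S \<in> A \<Longrightarrow> S \<le> Abs_regular_operator f" for S
      unfolding less_eq_regular_operator_def rep using f_pos g_ub rk_sums_single by metis
    show "\<forall>S\<in>A. S \<le> U \<Longrightarrow> Abs_regular_operator f \<le> U" for U
      unfolding less_eq_regular_operator_def rep using f_pos g_least rk_sums_le
      by (metis less_eq_regular_operator_def)
  qed
qed

instantiation regular_operator :: (dedekind_complete_vector_lattice) dedekind_complete_vector_lattice
begin

definition Sup_regular_operator :: "'a regular_operator set \<Rightarrow> 'a regular_operator" where
  "Sup A = (THE L :: 'a regular_operator. (\<forall>S\<in>A. S \<le> L) \<and> (\<forall>U. (\<forall>S\<in>A. S \<le> U) \<longrightarrow> L \<le> U))"

definition Inf_regular_operator :: "'a regular_operator set \<Rightarrow> 'a regular_operator" where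
  "Inf A = - Sup (uminus ` A :: 'a regular_operator set)"

definition sup_regular_operator ::
  "'a regular_operator \<Rightarrow> 'a regular_operator \<Rightarrow> 'a regular_operator" where
  "sup S T = Sup {S, T :: 'a regular_operator}"

definition inf_regular_operator ::
  "'a regular_operator \<Rightarrow> 'a regular_operator \<Rightarrow> 'a regular_operator" where
  "inf S T = Inf {S, T :: 'a regular_operator}"

definition abs_regular_operator :: "'a regular_operator \<Rightarrow> 'a regular_operator" where
  "\<bar>T\<bar> = sup T (- T :: 'a regular_operator)"

instance
proof -
  have SupE: "(\<forall>S\<in>A. S \<le> Sup A) \<and> (\<forall>U. (\<forall>S\<in>A. S \<le> U) \<longrightarrow> Sup A \<le> U)"
    if A: "A \<noteq> {}" "\<And>S. S \<in> A \<Longrightarrow> S \<le> B" for A :: "'a regular_operator set" and B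
  proof -
    obtain L where L: "(\<forall>S\<in>A. S \<le> L) \<and> (\<forall>U. (\<forall>S\<in>A. S \<le> U) \<longrightarrow> L \<le> U)"
      using regular_operator_lub_exists[OF A] by blast
    show ?thesis unfolding Sup_regular_operator_def
      by (rule theI[of _ L]) (use L in \<open>auto intro: antisym\<close>)
  qed
  have SupU: "S \<in> A \<Longrightarrow> bdd_above A \<Longrightarrow> S \<le> Sup A" for A and S :: "'a regular_operator"
    using SupE[of A] by (auto simp: bdd_above_def)
  have SupL: "A \<noteq> {} \<Longrightarrow> (\<And>S. S \<in> A \<Longrightarrow> S \<le> B) \<Longrightarrow> Sup A \<le> B" for A and B :: "'a regular_operator"
    using SupE[of A B] by blast
  have InfU: "S \<in> A \<Longrightarrow> bdd_below A \<Longrightarrow> Inf A \<le> S" for A and S :: "'a regular_operator"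
    unfolding Inf_regular_operator_def using SupU[of "- S" "uminus ` A"]
    by (metis bdd_above_uminus image_eqI minus_le_iff)
  have InfL: "B \<le> Inf A" if "A \<noteq> {}" "\<And>S. S \<in> A \<Longrightarrow> B \<le> S" for A and B :: "'a regular_operator"
  proof -
    have "Sup (uminus ` A) \<le> - B" by (rule SupL) (use that in auto)
    then show ?thesis unfolding Inf_regular_operator_def by (subst le_minus_iff)
  qed
  have bdd: "bdd_above {x, y}" if "x \<le> u" "y \<le> u" for x y u :: "'a regular_operator"
    using that by (auto simp: bdd_above_def)
  have ex: "\<exists>u. x \<le> u \<and> y \<le> u" for x y :: "'a regular_operator"
  proof -
    obtain P Q where x: "positive_operator P" "positive_operator Q" "rapply x = (\<lambda>v. P v - Q v)"
      by (rule rapply_pos)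
    obtain P' Q' where y: "positive_operator P'" "positive_operator Q'" "rapply y = (\<lambda>v. P' v - Q' v)"
      by (rule rapply_pos)
    have "positive_operator (\<lambda>v. 0 :: 'a)" by (simp add: positive_operator_def module_hom_zero)
    then have u: "rapply (Abs_regular_operator (\<lambda>v. P v + P' v)) = (\<lambda>v. P v + P' v)"
      using positive_operator_add[OF x(1) y(1)]
      by (intro Abs_regular_operator_inverse CollectI exI[of _ "\<lambda>v. P v + P' v"] exI[of _ "\<lambda>v. 0"])
        auto
    have le: "a - b \<le> a + c" "a - b \<le> c + a" if "0 \<le> b" "0 \<le> c" for a b c :: 'a
      using add_nonneg_nonneg[OF that] by (simp_all add: diff_le_eq algebra_simps)
    show ?thesis
      by (rule exI[of _ "Abs_regular_operator (\<lambda>v. P v + P' v)"])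
        (use x(1,2) y(1,2) in \<open>simp add: u x(3) y(3) less_eq_regular_operator_def positive_operator_def le\<close>)
  qed
  have ba: "bdd_above {x, y}" for x y :: "'a regular_operator" using ex[of x y] by (auto intro: bdd)
  have bb: "bdd_below {x, y}" for x y :: "'a regular_operator"
  proof -
    obtain u where u: "- x \<le> u" "- y \<le> u" using ex by blast
    then show ?thesis by (intro bdd_belowI[of _ "- u"]) (auto simp: minus_le_iff)
  qed
  show "OFCLASS('a regular_operator, dedekind_complete_vector_lattice_class)"
  proof
    fix x y z :: "'a regular_operator" and X :: "'a regular_operator set"
    show "inf x y \<le> x" "inf x y \<le> y" unfolding inf_regular_operator_def
      by (rule InfU[OF _ bb]; simp)+
    show "x \<le> y \<Longrightarrow> x \<le> z \<Longrightarrow> x \<le> inf y z" unfolding inf_regular_operator_def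
      by (rule InfL) auto
    show "x \<le> sup x y" "y \<le> sup x y" unfolding sup_regular_operator_def
      by (rule SupU[OF _ ba]; simp)+
    show "y \<le> x \<Longrightarrow> z \<le> x \<Longrightarrow> sup y z \<le> x" unfolding sup_regular_operator_def
      by (rule SupL) auto
    show "\<bar>x\<bar> = sup x (- x)" by (rule abs_regular_operator_def)
    show "x \<in> X \<Longrightarrow> bdd_below X \<Longrightarrow> Inf X \<le> x" by (rule InfU)
    show "X \<noteq> {} \<Longrightarrow> (\<And>x. x \<in> X \<Longrightarrow> z \<le> x) \<Longrightarrow> z \<le> Inf X" by (rule InfL)
    show "x \<in> X \<Longrightarrow> bdd_above X \<Longrightarrow> x \<le> Sup X" by (rule SupU)
    show "X \<noteq> {} \<Longrightarrow> (\<And>x. x \<in> X \<Longrightarrow> x \<le> z) \<Longrightarrow> Sup X \<le> z" by (rule SupL)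
  qed
qed

end


section \<open>The centre\<close>

typedef (overloaded) 'a::dedekind_complete_vector_lattice center =
  "{T :: 'a regular_operator. \<exists>l\<ge>0. \<bar>T\<bar> \<le> l *\<^sub>R 1}"
  morphisms center_op Abs_center
  by (rule exI[of _ 0]) (auto intro!: exI[of _ 0])

setup_lifting type_definition_center

lemma center_iff:
  fixes T :: "'a::dedekind_complete_vector_lattice regular_operator"
  shows "(\<exists>l\<ge>0. \<bar>T\<bar> \<le> l *\<^sub>R 1) \<longleftrightarrow> (\<exists>l\<ge>0. T \<le> l *\<^sub>R 1 \<and> - (l *\<^sub>R 1) \<le> T)"
  by (meson abs_le_D1 abs_le_D2 abs_leI minus_le_iff)

lemma regular_one_nonneg: "0 \<le> (1 :: 'a::dedekind_complete_vector_lattice regular_operator)"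
  by (simp add: less_eq_regular_operator_def)

lemma center_convex:
  fixes S T U :: "'a::dedekind_complete_vector_lattice regular_operator"
  assumes "\<exists>l\<ge>0. \<bar>S\<bar> \<le> l *\<^sub>R 1" "\<exists>l\<ge>0. \<bar>U\<bar> \<le> l *\<^sub>R 1" "S \<le> T" "T \<le> U"
  shows "\<exists>l\<ge>0. \<bar>T\<bar> \<le> l *\<^sub>R 1"
proof -
  obtain l m where lm: "0 \<le> l" "\<bar>S\<bar> \<le> l *\<^sub>R 1" "0 \<le> m" "\<bar>U\<bar> \<le> m *\<^sub>R 1" using assms by blast
  have nn: "0 \<le> l *\<^sub>R (1 :: 'a regular_operator)" "0 \<le> m *\<^sub>R (1 :: 'a regular_operator)"
    using lm by (simp_all add: scaleR_nonneg_nonneg regular_one_nonneg)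
  have "T \<le> m *\<^sub>R 1" using assms(4) abs_le_D1[OF lm(4)] by (rule order_trans)
  moreover have "- T \<le> l *\<^sub>R 1" using assms(3) abs_le_D2[OF lm(2)] by (meson neg_le_iff_le order_trans)
  ultimately have "\<bar>T\<bar> \<le> (l + m) *\<^sub>R 1"
    using nn by (intro abs_leI) (auto simp: scaleR_add_left intro: add_increasing add_increasing2)
  then show ?thesis using lm by (intro exI[of _ "l + m"]) auto
qed

lemma center_add:
  fixes S T :: "'a::dedekind_complete_vector_lattice regular_operator"
  assumes "\<exists>l\<ge>0. \<bar>S\<bar> \<le> l *\<^sub>R 1" "\<exists>l\<ge>0. \<bar>T\<bar> \<le> l *\<^sub>R 1"
  shows "\<exists>l\<ge>0. \<bar>S + T\<bar> \<le> l *\<^sub>R 1"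
proof -
  obtain l m where lm: "0 \<le> l" "\<bar>S\<bar> \<le> l *\<^sub>R 1" "0 \<le> m" "\<bar>T\<bar> \<le> m *\<^sub>R 1" using assms by blast
  have "\<bar>S + T\<bar> \<le> \<bar>S\<bar> + \<bar>T\<bar>" by (rule abs_triangle_ineq)
  also have "\<dots> \<le> (l + m) *\<^sub>R 1" using lm by (simp add: scaleR_add_left add_mono)
  finally show ?thesis using lm by (intro exI[of _ "l + m"]) auto
qed

lemma center_uminus:
  fixes T :: "'a::dedekind_complete_vector_lattice regular_operator"
  shows "\<exists>l\<ge>0. \<bar>T\<bar> \<le> l *\<^sub>R 1 \<Longrightarrow> \<exists>l\<ge>0. \<bar>- T\<bar> \<le> l *\<^sub>R 1"
  by simp

lemma center_scaleR:
  fixes T :: "'a::dedekind_complete_vector_lattice regular_operator"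
  assumes "\<exists>l\<ge>0. \<bar>T\<bar> \<le> l *\<^sub>R 1"
  shows "\<exists>l\<ge>0. \<bar>r *\<^sub>R T\<bar> \<le> l *\<^sub>R 1"
proof -
  obtain l where l: "0 \<le> l" "\<bar>T\<bar> \<le> l *\<^sub>R 1" using assms by blast
  have *: "\<bar>r *\<^sub>R T\<bar> \<le> r *\<^sub>R l *\<^sub>R 1" if "0 \<le> r" "\<bar>T\<bar> \<le> l *\<^sub>R 1"
    for r and T :: "'a regular_operator"
    using scaleR_left_mono[OF abs_le_D1[OF that(2)] that(1)]
      scaleR_left_mono[OF abs_le_D2[OF that(2)] that(1)]
    by (intro abs_leI) auto
  have "\<bar>r *\<^sub>R T\<bar> \<le> (\<bar>r\<bar> * l) *\<^sub>R 1"
    using *[of r T] *[of "- r" "- T"] l by (cases "0 \<le> r") auto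
  then show ?thesis using l by (intro exI[of _ "\<bar>r\<bar> * l"]) auto
qed

lemma center_times:
  fixes S T :: "'a::dedekind_complete_vector_lattice regular_operator"
  assumes "\<exists>l\<ge>0. \<bar>S\<bar> \<le> l *\<^sub>R 1" "\<exists>l\<ge>0. \<bar>T\<bar> \<le> l *\<^sub>R 1"
  shows "\<exists>l\<ge>0. \<bar>S * T\<bar> \<le> l *\<^sub>R 1"
proof -
  obtain l m where l: "0 \<le> l" "S \<le> l *\<^sub>R 1" "- (l *\<^sub>R 1) \<le> S"
    and m: "0 \<le> m" "T \<le> m *\<^sub>R 1" "- (m *\<^sub>R 1) \<le> T"
    using assms unfolding center_iff by metis
  have b: "\<bar>rapply S (rapply T x)\<bar> \<le> (3 * (l * m)) *\<^sub>R x" if x: "0 \<le> x" for x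
  proof -
    have S: "\<bar>rapply S y\<bar> \<le> l *\<^sub>R y" if "0 \<le> y" for y
      using l that by (intro abs_leI) (auto simp: less_eq_regular_operator_def minus_le_iff)
    define y where "y = rapply T x + m *\<^sub>R x"
    have y: "0 \<le> y" "y \<le> (2 * m) *\<^sub>R x"
    proof -
      have 1: "- (m *\<^sub>R x) \<le> rapply T x" "rapply T x \<le> m *\<^sub>R x"
        using m x by (auto simp: less_eq_regular_operator_def)
      show "0 \<le> y" unfolding y_def using 1(1) by (simp add: minus_le_iff le_minus_iff) (metis add.commute diff_0 diff_le_eq)
      have "(2 * m) *\<^sub>R x = m *\<^sub>R x + m *\<^sub>R x" by (metis mult_2 scaleR_add_left)
      then show "y \<le> (2 * m) *\<^sub>R x" unfolding y_def using 1(2) by (simp add: add_mono)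
    qed
    have mx: "0 \<le> m *\<^sub>R x" using x m by (simp add: scaleR_nonneg_nonneg)
    have "rapply S (rapply T x) = rapply S y - rapply S (m *\<^sub>R x)"
      unfolding y_def by (simp add: linear_add[OF linear_rapply])
    then have "\<bar>rapply S (rapply T x)\<bar> \<le> \<bar>rapply S y\<bar> + \<bar>rapply S (m *\<^sub>R x)\<bar>"
      by (simp add: abs_triangle_ineq4)
    also have "\<dots> \<le> l *\<^sub>R y + l *\<^sub>R m *\<^sub>R x" using S[OF y(1)] S[OF mx] by (rule add_mono)
    also have "\<dots> \<le> l *\<^sub>R (2 * m) *\<^sub>R x + l *\<^sub>R m *\<^sub>R x"
      using scaleR_left_mono[OF y(2) l(1)] by simp
    also have "\<dots> = (l * (2 * m) + l * m) *\<^sub>R x" by (simp only: scaleR_scaleR scaleR_add_left)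
    also have "l * (2 * m) + l * m = 3 * (l * m)" by simp
    finally show ?thesis .
  qed
  have "S * T \<le> (3 * (l * m)) *\<^sub>R 1" "- (S * T) \<le> (3 * (l * m)) *\<^sub>R 1"
    using abs_le_D1[OF b] abs_le_D2[OF b] by (auto simp: less_eq_regular_operator_def)
  then have "\<bar>S * T\<bar> \<le> (3 * (l * m)) *\<^sub>R 1" by (rule abs_leI)
  then show ?thesis using l m by (intro exI[of _ "3 * (l * m)"]) auto
qed

lemma center_sup:
  fixes S T :: "'a::dedekind_complete_vector_lattice regular_operator"
  assumes "\<exists>l\<ge>0. \<bar>S\<bar> \<le> l *\<^sub>R 1" "\<exists>l\<ge>0. \<bar>T\<bar> \<le> l *\<^sub>R 1"
  shows "\<exists>l\<ge>0. \<bar>sup S T\<bar> \<le> l *\<^sub>R 1"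
proof (rule center_convex[of S "\<bar>S\<bar> + \<bar>T\<bar>"])
  show "\<exists>l\<ge>0. \<bar>\<bar>S\<bar> + \<bar>T\<bar>\<bar> \<le> l *\<^sub>R 1" using assms by (intro center_add) auto
  show "sup S T \<le> \<bar>S\<bar> + \<bar>T\<bar>" 
    by (rule sup_least[OF add_increasing2[OF abs_ge_zero abs_ge_self] add_increasing[OF abs_ge_zero abs_ge_self]])
qed (use assms in auto)

lemma center_inf:
  fixes S T :: "'a::dedekind_complete_vector_lattice regular_operator"
  assumes "\<exists>l\<ge>0. \<bar>S\<bar> \<le> l *\<^sub>R 1" "\<exists>l\<ge>0. \<bar>T\<bar> \<le> l *\<^sub>R 1"
  shows "\<exists>l\<ge>0. \<bar>inf S T\<bar> \<le> l *\<^sub>R 1"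
  unfolding inf_eq_neg_sup using assms by (intro center_uminus center_sup)

instantiation center :: (dedekind_complete_vector_lattice)
  "{ordered_real_vector, real_algebra, monoid_mult, lattice_ab_group_add_abs}"
begin

lift_definition zero_center :: "'a center" is 0 by (auto intro!: exI[of _ 0])

lift_definition one_center :: "'a center" is 1
  by (rule exI[of _ 1]) (auto simp: regular_one_nonneg)

lift_definition plus_center :: "'a center \<Rightarrow> 'a center \<Rightarrow> 'a center" is "(+)" by (rule center_add)

lift_definition uminus_center :: "'a center \<Rightarrow> 'a center" is uminus by (rule center_uminus)

lift_definition minus_center :: "'a center \<Rightarrow> 'a center \<Rightarrow> 'a center" is "(-)"
  unfolding diff_conv_add_uminus by (intro center_add center_uminus)

lift_definition scaleR_center :: "real \<Rightarrow> 'a center \<Rightarrow> 'a center" is "(*\<^sub>R)" by (rule center_scaleR)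

lift_definition times_center :: "'a center \<Rightarrow> 'a center \<Rightarrow> 'a center" is "(*)" by (rule center_times)

lift_definition sup_center :: "'a center \<Rightarrow> 'a center \<Rightarrow> 'a center" is sup by (rule center_sup)

lift_definition inf_center :: "'a center \<Rightarrow> 'a center \<Rightarrow> 'a center" is inf by (rule center_inf)

lift_definition abs_center :: "'a center \<Rightarrow> 'a center" is abs by simp

lift_definition less_eq_center :: "'a center \<Rightarrow> 'a center \<Rightarrow> bool" is "(\<le>)" .

lift_definition less_center :: "'a center \<Rightarrow> 'a center \<Rightarrow> bool" is "(<)" .

instance
  by standard
    (transfer; auto simp: algebra_simps scaleR_add_left scaleR_add_right abs_lattice
      intro: scaleR_left_mono scaleR_right_mono order_antisym)+

end

instantiation center :: (dedekind_complete_vector_lattice) dedekind_complete_vector_lattice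
begin

definition Sup_center :: "'a center set \<Rightarrow> 'a center" where
  "Sup A = Abs_center (Sup (center_op ` A))"

definition Inf_center :: "'a center set \<Rightarrow> 'a center" where
  "Inf A = Abs_center (Inf (center_op ` A))"

instance
proof
  fix x z :: "'a center" and X :: "'a center set"
  have Sup: "center_op (Sup X) = Sup (center_op ` X) \<and> bdd_above (center_op ` X)"
    if "x \<in> X" "\<And>y. y \<in> X \<Longrightarrow> y \<le> b" for x b and X :: "'a center set"
  proof -
    have b: "bdd_above (center_op ` X)" using that(2)
      by (auto intro!: bdd_aboveI[of _ "center_op b"] simp: less_eq_center.rep_eq)
    have "\<exists>l\<ge>0. \<bar>Sup (center_op ` X)\<bar> \<le> l *\<^sub>R 1"
      by (rule center_convex[of "center_op x" "center_op b"])
        (use center_op[of x] center_op[of b] that b in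
          \<open>auto intro: cSup_upper cSup_least simp: less_eq_center.rep_eq\<close>)
    then show ?thesis unfolding Sup_center_def using b by (simp add: Abs_center_inverse)
  qed
  have Inf: "center_op (Inf X) = Inf (center_op ` X) \<and> bdd_below (center_op ` X)"
    if "x \<in> X" "\<And>y. y \<in> X \<Longrightarrow> b \<le> y" for x b and X :: "'a center set"
  proof -
    have b: "bdd_below (center_op ` X)" using that(2)
      by (auto intro!: bdd_belowI[of _ "center_op b"] simp: less_eq_center.rep_eq)
    have "\<exists>l\<ge>0. \<bar>Inf (center_op ` X)\<bar> \<le> l *\<^sub>R 1"
      by (rule center_convex[of "center_op b" "center_op x"])
        (use center_op[of x] center_op[of b] that b in
          \<open>auto intro: cInf_lower cInf_greatest simp: less_eq_center.rep_eq\<close>)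
    then show ?thesis unfolding Inf_center_def using b by (simp add: Abs_center_inverse)
  qed
  show "Inf X \<le> x" if xX: "x \<in> X" and bX: "bdd_below X"
  proof -
    obtain b where b: "\<And>y. y \<in> X \<Longrightarrow> b \<le> y" using bX by (auto simp: bdd_below_def)
    show ?thesis using Inf[OF xX b] xX
      by (auto simp: less_eq_center.rep_eq intro: cInf_lower)
  qed
  show "X \<noteq> {} \<Longrightarrow> (\<And>x. x \<in> X \<Longrightarrow> z \<le> x) \<Longrightarrow> z \<le> Inf X"
    using Inf[of _ X z] by (auto simp: less_eq_center.rep_eq intro!: cInf_greatest)
  show "x \<le> Sup X" if xX: "x \<in> X" and bX: "bdd_above X"
  proof -
    obtain b where b: "\<And>y. y \<in> X \<Longrightarrow> y \<le> b" using bX by (auto simp: bdd_above_def)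
    show ?thesis using Sup[OF xX b] xX
      by (auto simp: less_eq_center.rep_eq intro: cSup_upper)
  qed
  show "X \<noteq> {} \<Longrightarrow> (\<And>x. x \<in> X \<Longrightarrow> x \<le> z) \<Longrightarrow> Sup X \<le> z"
    using Sup[of _ X z] by (auto simp: less_eq_center.rep_eq intro!: cSup_least)
qed

end


section \<open>Complexification\<close>

datatype 'a complexification = Cplx (cRe: 'a) (cIm: 'a)

instantiation complexification :: (real_vector) real_vector
begin

definition "0 = Cplx (0 :: 'a) 0"
definition "z + w = Cplx (cRe z + cRe w :: 'a) (cIm z + cIm w)"
definition "z - w = Cplx (cRe z - cRe w :: 'a) (cIm z - cIm w)"
definition "- z = Cplx (- cRe z :: 'a) (- cIm z)"
definition "r *\<^sub>R z = Cplx (r *\<^sub>R cRe z :: 'a) (r *\<^sub>R cIm z)"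

instance
  by standard
    (auto simp: zero_complexification_def plus_complexification_def minus_complexification_def
      uminus_complexification_def scaleR_complexification_def algebra_simps
      intro!: complexification.expand)

end

lemma complexification_sel [simp]:
  "cRe 0 = 0" "cIm 0 = 0" "cRe (z + w) = cRe z + cRe w" "cIm (z + w) = cIm z + cIm w"
  "cRe (z - w) = cRe z - cRe w" "cIm (z - w) = cIm z - cIm w"
  "cRe (- z) = - cRe z" "cIm (- z) = - cIm z"
  "cRe (r *\<^sub>R z) = r *\<^sub>R cRe z" "cIm (r *\<^sub>R z) = r *\<^sub>R cIm z"
  by (auto simp: zero_complexification_def plus_complexification_def minus_complexification_def
      uminus_complexification_def scaleR_complexification_def)

instantiation complexification :: ("{zero, one}") one
begin
definition "1 = Cplx (1 :: 'a) 0"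
instance ..
end

definition complexify :: "'a::zero \<Rightarrow> 'a complexification" where
  "complexify x = Cplx x 0"

definition scaleC :: "complex \<Rightarrow> 'a::real_vector complexification \<Rightarrow> 'a complexification"
  (infixr "*\<^sub>C" 75) where
  "c *\<^sub>C z = Cplx (Re c *\<^sub>R cRe z - Im c *\<^sub>R cIm z) (Re c *\<^sub>R cIm z + Im c *\<^sub>R cRe z)"

definition modulus :: "'a::dedekind_complete_vector_lattice complexification \<Rightarrow> 'a" where
  "modulus z = (SUP \<theta>::real. cos \<theta> *\<^sub>R cRe z + sin \<theta> *\<^sub>R cIm z)"

lemma scaleR_le_abs:
  fixes x :: "'a::dedekind_complete_vector_lattice"
  assumes "\<bar>r\<bar> \<le> 1" shows "r *\<^sub>R x \<le> \<bar>x\<bar>"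
proof (cases "0 \<le> r")
  case True
  then have "r *\<^sub>R x \<le> r *\<^sub>R \<bar>x\<bar>" by (simp add: scaleR_left_mono abs_ge_self)
  also have "\<dots> \<le> 1 *\<^sub>R \<bar>x\<bar>" using assms by (intro scaleR_right_mono) auto
  finally show ?thesis by simp
next
  case False
  then have "r *\<^sub>R x = (-r) *\<^sub>R (- x)" by simp
  also have "\<dots> \<le> (-r) *\<^sub>R \<bar>x\<bar>" using False by (intro scaleR_left_mono abs_ge_minus_self) auto
  also have "\<dots> \<le> 1 *\<^sub>R \<bar>x\<bar>" using assms by (intro scaleR_right_mono) auto
  finally show ?thesis by simp
qed

lemma modulus_term_le: "cos \<theta> *\<^sub>R cRe z + sin \<theta> *\<^sub>R cIm z \<le> \<bar>cRe z\<bar> + \<bar>cIm z\<bar>"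
  for z :: "'a::dedekind_complete_vector_lattice complexification"
  by (intro add_mono scaleR_le_abs) auto

lemma modulus_upper: "cos \<theta> *\<^sub>R cRe z + sin \<theta> *\<^sub>R cIm z \<le> modulus z"
  for z :: "'a::dedekind_complete_vector_lattice complexification"
  unfolding modulus_def
  by (rule cSUP_upper) (auto intro!: bdd_aboveI2[of _ _ "\<bar>cRe z\<bar> + \<bar>cIm z\<bar>"] modulus_term_le)

lemma modulus_least: "(\<And>\<theta>. cos \<theta> *\<^sub>R cRe z + sin \<theta> *\<^sub>R cIm z \<le> b) \<Longrightarrow> modulus z \<le> b"
  for z :: "'a::dedekind_complete_vector_lattice complexification"
  unfolding modulus_def by (rule cSUP_least) auto

lemma modulus_le_abs_add: "modulus z \<le> \<bar>cRe z\<bar> + \<bar>cIm z\<bar>"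
  for z :: "'a::dedekind_complete_vector_lattice complexification"
  by (rule modulus_least) (rule modulus_term_le)

lemma abs_cRe_le_modulus: "\<bar>cRe z\<bar> \<le> modulus z"
  for z :: "'a::dedekind_complete_vector_lattice complexification"
  using modulus_upper[of 0 z] modulus_upper[of pi z] by (intro abs_leI) auto

lemma abs_cIm_le_modulus: "\<bar>cIm z\<bar> \<le> modulus z"
  for z :: "'a::dedekind_complete_vector_lattice complexification"
  using modulus_upper[of "pi/2" z] modulus_upper[of "- (pi/2)" z] by (intro abs_leI) auto

lemma modulus_nonneg: "0 \<le> modulus z"
  for z :: "'a::dedekind_complete_vector_lattice complexification"
  using abs_ge_zero abs_cRe_le_modulus by (rule order_trans)

lemma modulus_triangle: "modulus (z + w) \<le> modulus z + modulus w"
  for z w :: "'a::dedekind_complete_vector_lattice complexification"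
proof (rule modulus_least)
  fix \<theta>
  show "cos \<theta> *\<^sub>R cRe (z + w) + sin \<theta> *\<^sub>R cIm (z + w) \<le> modulus z + modulus w"
    using add_mono[OF modulus_upper[of \<theta> z] modulus_upper[of \<theta> w]]
    by (simp add: scaleR_add_right algebra_simps)
qed

lemma modulus_scaleR: "modulus (r *\<^sub>R z) = \<bar>r\<bar> *\<^sub>R modulus z"
  for z :: "'a::dedekind_complete_vector_lattice complexification"
proof -
  have le: "modulus (r *\<^sub>R z) \<le> \<bar>r\<bar> *\<^sub>R modulus z" for r and z :: "'a complexification"
  proof (rule modulus_least)
    fix \<theta> :: real
    define t where "t = (if 0 \<le> r then \<theta> else \<theta> + pi)"
    have "cos \<theta> *\<^sub>R cRe (r *\<^sub>R z) + sin \<theta> *\<^sub>R cIm (r *\<^sub>R z)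
        = \<bar>r\<bar> *\<^sub>R (cos t *\<^sub>R cRe z + sin t *\<^sub>R cIm z)"
      by (auto simp: t_def scaleR_add_right mult.commute)
    also have "\<dots> \<le> \<bar>r\<bar> *\<^sub>R modulus z" by (intro scaleR_left_mono modulus_upper) auto
    finally show "cos \<theta> *\<^sub>R cRe (r *\<^sub>R z) + sin \<theta> *\<^sub>R cIm (r *\<^sub>R z) \<le> \<bar>r\<bar> *\<^sub>R modulus z" .
  qed
  show ?thesis
  proof (cases "r = 0")
    case True
    then show ?thesis using le[of 0 z] modulus_nonneg[of "r *\<^sub>R z"] by (intro antisym) auto
  next
    case False
    have "modulus z \<le> \<bar>1/r\<bar> *\<^sub>R modulus (r *\<^sub>R z)" using le[of "1/r" "r *\<^sub>R z"] False by simp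
    then have "\<bar>r\<bar> *\<^sub>R modulus z \<le> \<bar>r\<bar> *\<^sub>R \<bar>1/r\<bar> *\<^sub>R modulus (r *\<^sub>R z)"
      by (rule scaleR_left_mono) auto
    then show ?thesis using le[of r z] False by (intro antisym) (auto simp flip: abs_mult)
  qed
qed

text \<open>The identity \<open>Z(E\<^sub>\<complex>) = Z(E) + iZ(E)\<close>: an element of
  \<open>Z(E\<^sub>\<complex>)\<close> can be represented as one of type \<open>'a center complexification\<close>.\<close>

lemma center_complexification_iff:
  fixes T :: "'a::dedekind_complete_vector_lattice regular_operator complexification"
  shows "(\<exists>l\<ge>0. modulus T \<le> l *\<^sub>R 1) \<longleftrightarrow> T \<in> range (map_complexification center_op)"
proof
  assume "\<exists>l\<ge>0. modulus T \<le> l *\<^sub>R 1"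
  then have "\<exists>l\<ge>0. \<bar>cRe T\<bar> \<le> l *\<^sub>R 1" "\<exists>l\<ge>0. \<bar>cIm T\<bar> \<le> l *\<^sub>R 1"
    using abs_cRe_le_modulus[of T] abs_cIm_le_modulus[of T] by (meson order_trans)+
  then have "T = map_complexification center_op (Cplx (Abs_center (cRe T)) (Abs_center (cIm T)))"
    by (simp add: Abs_center_inverse)
  then show "T \<in> range (map_complexification center_op)" by blast
next
  assume "T \<in> range (map_complexification center_op)"
  then obtain S where S: "T = map_complexification center_op S" by blast
  then have "\<exists>l\<ge>0. \<bar>\<bar>cRe T\<bar> + \<bar>cIm T\<bar>\<bar> \<le> l *\<^sub>R 1"
    using center_op[of "cRe S"] center_op[of "cIm S"] by (cases S) (intro center_add; simp)
  then show "\<exists>l\<ge>0. modulus T \<le> l *\<^sub>R 1"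
    using modulus_le_abs_add[of T] by (meson abs_le_D1 order_trans)
qed

instantiation complexification :: (dedekind_complete_banach_lattice) real_normed_vector
begin

definition norm_complexification :: "'a complexification \<Rightarrow> real" where
  "norm z = norm (modulus (z :: 'a complexification))"
definition dist_complexification :: "'a complexification \<Rightarrow> 'a complexification \<Rightarrow> real" where
  "dist z w = norm (z - w :: 'a complexification)"
definition sgn_complexification :: "'a complexification \<Rightarrow> 'a complexification" where
  "sgn z = z /\<^sub>R norm (z :: 'a complexification)"
definition uniformity_complexification ::
  "('a complexification \<times> 'a complexification) filter" where
  "uniformity_complexification = (INF e\<in>{0<..}. principal {(z, w). dist z w < e})"
definition open_complexification :: "'a complexification set \<Rightarrow> bool" where
  "open_complexification U \<longleftrightarrow> (\<forall>x\<in>U. \<forall>\<^sub>F (x', y) in uniformity. x' = x \<longrightarrow> y \<in> U)"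

instance
proof
  fix z w :: "'a complexification" and r :: real and U :: "'a complexification set"
  show "dist z w = norm (z - w)" by (rule dist_complexification_def)
  show "sgn z = z /\<^sub>R norm z" by (rule sgn_complexification_def)
  show "uniformity = (INF e\<in>{0<..}. principal {(z::'a complexification, w). dist z w < e})"
    by (rule uniformity_complexification_def)
  show "open U \<longleftrightarrow> (\<forall>x\<in>U. \<forall>\<^sub>F (x', y) in uniformity. x' = x \<longrightarrow> y \<in> U)"
    by (rule open_complexification_def)
  show "norm z = 0 \<longleftrightarrow> z = 0"
  proof
    assume "norm z = 0"
    then have "modulus z = 0" by (simp add: norm_complexification_def)
    then have "\<bar>cRe z\<bar> \<le> 0" "\<bar>cIm z\<bar> \<le> 0"
      using abs_cRe_le_modulus[of z] abs_cIm_le_modulus[of z] by simp_all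
    then show "z = 0" by (intro complexification.expand) simp
  next
    assume "z = 0"
    then show "norm z = 0" using modulus_scaleR[of 0 z] by (simp add: norm_complexification_def)
  qed
  have "norm (modulus (z + w)) \<le> norm (modulus z + modulus w)"
    using modulus_triangle[of z w] modulus_nonneg[of z] modulus_nonneg[of w] modulus_nonneg[of "z + w"]
    by (intro norm_mono_abs) simp
  then show "norm (z + w) \<le> norm z + norm w"
    unfolding norm_complexification_def using norm_triangle_ineq order_trans by blast
  show "norm (r *\<^sub>R z) = \<bar>r\<bar> * norm z"
    by (simp add: norm_complexification_def modulus_scaleR)
qed

end


section \<open>Operators on the complexification\<close>

definition capply ::
  "'a::dedekind_complete_vector_lattice center complexification \<Rightarrow>
   'a complexification \<Rightarrow> 'a complexification" where
  "capply T z =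
    (let R = rapply (center_op (cRe T)); S = rapply (center_op (cIm T))
     in Cplx (R (cRe z) - S (cIm z)) (R (cIm z) + S (cRe z)))"

definition bounded_complex_operator ::
  "('a::dedekind_complete_banach_lattice complexification \<Rightarrow> 'a complexification) \<Rightarrow> bool" where
  "bounded_complex_operator A \<longleftrightarrow> bounded_linear A \<and> (\<forall>c z. A (c *\<^sub>C z) = c *\<^sub>C A z)"

definition spectrum ::
  "('a::dedekind_complete_banach_lattice complexification \<Rightarrow> 'a complexification) \<Rightarrow> complex set" where
  "spectrum A = {l. \<not> (\<exists>B. bounded_complex_operator B \<and>
     (\<forall>z. B (A z - l *\<^sub>C z) = z) \<and> (\<forall>z. A (B z) - l *\<^sub>C B z = z))}"


section \<open>Order continuity and order convergence\<close>

text \<open>The condition on \<open>D\<close> below says that \<open>\<phi>(x\<^sub>\<alpha>) \<rightarrow> 0\<close> for every net with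
  \<open>x\<^sub>\<alpha> \<down> 0\<close>; such a net may be replaced by its range, a downward directed set
  indexed by itself.\<close>

definition order_continuous_dual ::
  "('f::dedekind_complete_vector_lattice \<Rightarrow> real) set" where
  "order_continuous_dual = {\<phi>. linear \<phi> \<and>
     (\<forall>a b. bounded (\<phi> ` {a..b})) \<and>
     (\<forall>D. D \<noteq> {} \<and> (\<forall>x\<in>D. \<forall>y\<in>D. \<exists>d\<in>D. d \<le> x \<and> d \<le> y) \<and> bdd_below D \<and> Inf D = 0 \<longrightarrow>
       (\<forall>\<epsilon>>0. \<exists>d\<^sub>0\<in>D. \<forall>d\<in>D. d \<le> d\<^sub>0 \<longrightarrow> \<bar>\<phi> d\<bar> < \<epsilon>))}"

definition normal_lattice :: "'f::dedekind_complete_vector_lattice itself \<Rightarrow> bool" where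
  "normal_lattice _ \<longleftrightarrow> (\<forall>x::'f. x \<noteq> 0 \<longrightarrow> (\<exists>\<phi>\<in>order_continuous_dual. \<phi> x \<noteq> 0))"

definition decreases_to_zero :: "(nat \<Rightarrow> 'f::dedekind_complete_vector_lattice) \<Rightarrow> bool" where
  "decreases_to_zero u \<longleftrightarrow> decseq u \<and> bdd_below (range u) \<and> (INF n. u n) = 0"

definition sigma_order_convergent ::
  "(nat \<Rightarrow> 'f::dedekind_complete_vector_lattice complexification) \<Rightarrow> 'f complexification \<Rightarrow> bool" where
  "sigma_order_convergent z w \<longleftrightarrow>
     (\<exists>u. decreases_to_zero u \<and> (\<forall>n. modulus (z n - w) \<le> u n))"

definition sigma_order_sums ::
  "(nat \<Rightarrow> 'f::dedekind_complete_vector_lattice complexification) \<Rightarrow> 'f complexification \<Rightarrow> bool" where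
  "sigma_order_sums z w \<longleftrightarrow> sigma_order_convergent (\<lambda>N. \<Sum>n\<le>N. z n) w"


section \<open>Lattice-valued measures and order integrals\<close>

text \<open>The measure space \<open>M\<close> only serves to specify a set and a sigma-algebra of subsets.\<close>

definition lattice_measure ::
  "'b measure \<Rightarrow> ('b set \<Rightarrow> 'f::dedekind_complete_vector_lattice) \<Rightarrow> bool" where
  "lattice_measure M \<mu> \<longleftrightarrow> (\<forall>A\<in>sets M. 0 \<le> \<mu> A) \<and> \<mu> {} = 0 \<and>
     (\<forall>A::nat \<Rightarrow> 'b set. range A \<subseteq> sets M \<and> disjoint_family A \<longrightarrow>
        bdd_above (range (\<lambda>N. \<Sum>n\<le>N. \<mu> (A n))) \<and>
        \<mu> (\<Union>n. A n) = (SUP N. \<Sum>n\<le>N. \<mu> (A n)))"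

definition simple_order_integral ::
  "'b measure \<Rightarrow> ('b set \<Rightarrow> 'f::dedekind_complete_vector_lattice) \<Rightarrow> ('b \<Rightarrow> real) \<Rightarrow> 'f" where
  "simple_order_integral M \<mu> \<phi> = (\<Sum>r\<in>\<phi> ` space M. r *\<^sub>R \<mu> (\<phi> -` {r} \<inter> space M))"

text \<open>For a lattice measure \<open>\<mu>\<close> and a bounded measurable \<open>f \<ge> 0\<close>, the following
  does not depend on the choice of \<open>\<phi>\<close>.\<close>

definition nonneg_order_integral ::
  "'b measure \<Rightarrow> ('b set \<Rightarrow> 'f::dedekind_complete_vector_lattice) \<Rightarrow> ('b \<Rightarrow> real) \<Rightarrow> 'f" where
  "nonneg_order_integral M \<mu> f =
     (let \<phi> = (SOME \<phi>::nat \<Rightarrow> 'b \<Rightarrow> real. (\<forall>n. simple_function M (\<phi> n)) \<and>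
        (\<forall>x\<in>space M. (\<forall>n. 0 \<le> \<phi> n x) \<and> incseq (\<lambda>n. \<phi> n x) \<and> (\<lambda>n. \<phi> n x) \<longlonglongrightarrow> f x))
      in SUP n. simple_order_integral M \<mu> (\<phi> n))"

definition real_order_integral ::
  "'b measure \<Rightarrow> ('b set \<Rightarrow> 'f::dedekind_complete_vector_lattice) \<Rightarrow> ('b \<Rightarrow> real) \<Rightarrow> 'f" where
  "real_order_integral M \<mu> f =
     nonneg_order_integral M \<mu> (\<lambda>x. max (f x) 0) - nonneg_order_integral M \<mu> (\<lambda>x. max (- f x) 0)"

definition order_integral ::
  "'b measure \<Rightarrow> ('b set \<Rightarrow> 'f::dedekind_complete_vector_lattice) \<Rightarrow> ('b \<Rightarrow> complex) \<Rightarrow>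
   'f complexification" where
  "order_integral M \<mu> f =
     Cplx (real_order_integral M \<mu> (\<lambda>x. Re (f x))) (real_order_integral M \<mu> (\<lambda>x. Im (f x)))"

definition spectral_measure ::
  "'b measure \<Rightarrow> ('b set \<Rightarrow> 'a::dedekind_complete_vector_lattice center) \<Rightarrow> bool" where
  "spectral_measure M \<mu> \<longleftrightarrow> lattice_measure M \<mu> \<and>
     (\<forall>A\<in>sets M. \<forall>B\<in>sets M. \<mu> (A \<inter> B) = \<mu> A * \<mu> B)"

definition is_spectral_measure_of ::
  "(complex set \<Rightarrow> 'a::dedekind_complete_banach_lattice center) \<Rightarrow>
   'a center complexification \<Rightarrow> bool" where
  "is_spectral_measure_of \<mu> T \<longleftrightarrow>
     (let M = restrict_space borel (spectrum (capply T))
      in spectral_measure M \<mu> \<and> \<mu> (spectrum (capply T)) = 1 \<and> T = order_integral M \<mu> (\<lambda>x. x))"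

end

theory Submission
  imports Defs
begin

text \<open>Splitting off the points \<open>\<lambda>\<^sub>1, \<dots>, \<lambda>\<^sub>N\<close> of the countable, bounded
  spectrum, the integral of the identity differs from \<open>\<Sum>\<^sub>i\<^sub>\<le>\<^sub>N \<lambda>\<^sub>i P\<^sub>i\<close> by at most a
  constant times \<open>Q\<^sub>N = I - \<Sum>\<^sub>i\<^sub>\<le>\<^sub>N P\<^sub>i\<close>, and countable additivity gives \<open>Q\<^sub>N \<down> 0\<close>.
  Since \<open>P\<^sub>i Q\<^sub>N = 0\<close> for \<open>i \<le> N\<close>, multiplying this estimate by \<open>P\<^sub>i\<close> yields
  \<open>T P\<^sub>i = P\<^sub>i T = \<lambda>\<^sub>i P\<^sub>i\<close>. Hence \<open>P\<^sub>i\<close> annihilates the eigenspaces of all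
  other \<open>\<lambda>\<^sub>j\<close> and acts as the identity on its own, so applying it to any expansion of
  \<open>z\<close> into eigenvectors isolates the term with index \<open>i\<close>.\<close>

section \<open>Order limits in Dedekind complete vector lattices\<close>

text \<open>Replacing \<open>e\<close> by \<open>e / 2\<close> stays inside the family of multiples
  of \<open>b\<close>, so its infimum \<open>s\<close> satisfies
  \<open>2 *\<^sub>R s \<le> s\<close>, which forces \<open>s \<le> 0\<close>; and \<open>a\<close>
  is a lower bound, hence below \<open>s\<close>. Dedekind completeness provides
  \<open>s\<close>.\<close>

lemma archimedean_le_zero:
  fixes a b :: "'f::dedekind_complete_vector_lattice"
  assumes b: "0 \<le> b" and le: "\<And>e. 0 < e \<Longrightarrow> a \<le> e *\<^sub>R b"
  shows "a \<le> 0"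
proof -
  define S where "S = (\<lambda>e::real. e *\<^sub>R b) ` {0<..}"
  have ne: "S \<noteq> {}" unfolding S_def by (auto intro: exI[of _ 1])
  have bdd: "bdd_below S" unfolding S_def
    by (rule bdd_belowI2[of _ 0]) (use b in \<open>auto intro: scaleR_nonneg_nonneg\<close>)
  have "2 *\<^sub>R Inf S \<le> Inf S"
  proof (rule cInf_greatest[OF ne])
    fix x assume "x \<in> S"
    then obtain e where e: "0 < e" "x = e *\<^sub>R b" unfolding S_def by auto
    have "Inf S \<le> (e / 2) *\<^sub>R b" by (rule cInf_lower[OF _ bdd]) (use e in \<open>auto simp: S_def\<close>)
    then have "2 *\<^sub>R Inf S \<le> 2 *\<^sub>R (e / 2) *\<^sub>R b" by (rule scaleR_left_mono) simp
    then show "2 *\<^sub>R Inf S \<le> x" using e by simp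
  qed
  then have "Inf S \<le> 0" by (simp add: scaleR_2)
  moreover have "a \<le> Inf S" by (rule cInf_greatest[OF ne]) (use le in \<open>auto simp: S_def\<close>)
  ultimately show ?thesis by (rule order_trans[rotated])
qed

section \<open>Sequences decreasing to zero\<close>

lemma decreases_to_zeroI:
  fixes u :: "nat \<Rightarrow> 'f::dedekind_complete_vector_lattice"
  assumes "decseq u" "\<And>n. 0 \<le> u n" "\<And>b. (\<And>n. b \<le> u n) \<Longrightarrow> b \<le> 0"
  shows "decreases_to_zero u"
proof -
  have bdd: "bdd_below (range u)" using assms(2) by (rule bdd_belowI2)
  have "(INF n. u n) = 0"
  proof (rule antisym)
    show "(INF n. u n) \<le> 0" by (rule assms(3)) (rule cINF_lower[OF bdd UNIV_I])
    show "0 \<le> (INF n. u n)" by (rule cINF_greatest) (use assms(2) in auto)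
  qed
  then show ?thesis unfolding decreases_to_zero_def using assms(1) bdd by simp
qed

lemma
  fixes u :: "nat \<Rightarrow> 'f::dedekind_complete_vector_lattice"
  assumes u: "decreases_to_zero u"
  shows decreases_to_zero_decseq: "decseq u"
    and decreases_to_zero_nonneg: "0 \<le> u n"
    and decreases_to_zero_le: "(\<And>n. b \<le> u n) \<Longrightarrow> b \<le> 0"
    and decreases_to_zero_eventually_le: "(\<And>n. k \<le> n \<Longrightarrow> b \<le> u n) \<Longrightarrow> b \<le> 0"
proof -
  note u = u[unfolded decreases_to_zero_def]
  show dec: "decseq u" using u by simp
  show "0 \<le> u n" using cINF_lower[of u UNIV n] u by auto
  show *: "b \<le> 0" if "\<And>n. b \<le> u n" for b using cINF_greatest[of UNIV b u] u that by auto
  assume le: "\<And>n. k \<le> n \<Longrightarrow> b \<le> u n"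
  \<comment> \<open>For \<open>n\<close> below \<open>k\<close>, compare with the later and smaller
    term at index \<open>max k n\<close>.\<close>
  have "b \<le> u n" for n
    using le[of "max k n"] decseqD[OF dec, of n "max k n"] by (simp add: order_trans)
  then show "b \<le> 0" by (rule *)
qed

text \<open>A lower bound \<open>b\<close> of the sum involves one common index. Monotonicity
  decouples the two terms: \<open>b - u m \<le> v n\<close> for all \<open>n \<ge> m\<close>, so
  \<open>b \<le> u m\<close> for every \<open>m\<close>.\<close>

lemma decreases_to_zero_add:
  fixes u v :: "nat \<Rightarrow> 'f::dedekind_complete_vector_lattice"
  assumes u: "decreases_to_zero u" and v: "decreases_to_zero v"
  shows "decreases_to_zero (\<lambda>n. u n + v n)"
proof (rule decreases_to_zeroI)
  show "decseq (\<lambda>n. u n + v n)"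
    using assms[THEN decreases_to_zero_decseq] by (auto simp: decseq_def intro: add_mono)
  show "0 \<le> u n + v n" for n
    using assms[THEN decreases_to_zero_nonneg] by (rule add_nonneg_nonneg)
  fix b assume b: "\<And>n. b \<le> u n + v n"
  have "b - u m \<le> 0" for m
  proof (rule decreases_to_zero_eventually_le[OF v, of m])
    fix n assume "m \<le> n"
    then have "u n \<le> u m" using decreases_to_zero_decseq[OF u] by (simp add: decseqD)
    then have "b \<le> u m + v n" using b[of n] by (meson add_right_mono order_trans)
    then show "b - u m \<le> v n" by (simp add: algebra_simps)
  qed
  then show "b \<le> 0" using decreases_to_zero_le[OF u] by simp
qed

lemma decreases_to_zero_scaleR:
  fixes u :: "nat \<Rightarrow> 'f::dedekind_complete_vector_lattice"
  assumes u: "decreases_to_zero u" and r: "0 \<le> r"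
  shows "decreases_to_zero (\<lambda>n. r *\<^sub>R u n)"
proof (rule decreases_to_zeroI)
  show "decseq (\<lambda>n. r *\<^sub>R u n)"
    using decreases_to_zero_decseq[OF u] r by (auto simp: decseq_def intro: scaleR_left_mono)
  show "0 \<le> r *\<^sub>R u n" for n using decreases_to_zero_nonneg[OF u] r by (simp add: scaleR_nonneg_nonneg)
  fix b assume b: "\<And>n. b \<le> r *\<^sub>R u n"
  show "b \<le> 0"
  proof (cases "r = 0")
    case False
    have "(1/r) *\<^sub>R b \<le> u n" for n
      using scaleR_left_mono[OF b, of "1/r" n] r False by simp
    then have "(1/r) *\<^sub>R b \<le> 0" by (rule decreases_to_zero_le[OF u])
    then have "r *\<^sub>R (1/r) *\<^sub>R b \<le> r *\<^sub>R 0" using r by (rule scaleR_left_mono)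
    then show ?thesis using False by simp
  qed (use b in simp)
qed

text \<open>The operator infimum of a decreasing sequence is the pointwise one: the pointwise limit
  is linear, hence is itself a positive operator below all members of the sequence.\<close>

lemma decreases_to_zero_rapply:
  fixes Q :: "nat \<Rightarrow> 'a::dedekind_complete_vector_lattice center"
  assumes Q: "decreases_to_zero Q" and x: "0 \<le> x"
  shows "decreases_to_zero (\<lambda>n. rapply (center_op (Q n)) x)"
proof -
  let ?q = "\<lambda>n. rapply (center_op (Q n))"
  note lin = linear_rapply[of "center_op (Q n)" for n]
  \<comment> \<open>\<open>L x y\<close> says that \<open>?q n x\<close> converges in order to
    \<open>y\<close>. As a relation it can be shown additive and homogeneous at vectors of any sign,
    while the limit is first obtained, as an infimum, only at positive ones.\<close>
  define L where "L x y \<longleftrightarrow> (\<exists>u. decreases_to_zero u \<and> (\<forall>n. \<bar>?q n x - y\<bar> \<le> u n))" for x y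
  have pos: "0 \<le> ?q n x" if "0 \<le> x" for n x
    using decreases_to_zero_nonneg[OF Q] that by (simp add: less_eq_center.rep_eq less_eq_regular_operator_def zero_center.rep_eq)
  have dec: "decseq (\<lambda>n. ?q n x)" if "0 \<le> x" for x
    using decseqD[OF decreases_to_zero_decseq[OF Q]] that
    by (intro decseq_SucI) (simp add: less_eq_center.rep_eq less_eq_regular_operator_def)
  have bdd: "bdd_below (range (\<lambda>n. ?q n x))" if "0 \<le> x" for x
    using pos[OF that] by (rule bdd_belowI2)
  have L_add: "L (x + x') (y + y')" if L: "L x y" "L x' y'" for x x' y y'
  proof -
    obtain u u' where u: "decreases_to_zero u" "\<forall>n. \<bar>?q n x - y\<bar> \<le> u n"
      and u': "decreases_to_zero u'" "\<forall>n. \<bar>?q n x' - y'\<bar> \<le> u' n" using L unfolding L_def by blast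
    have "\<bar>?q n (x + x') - (y + y')\<bar> \<le> u n + u' n" for n
      using order_trans[OF abs_triangle_ineq add_mono[OF u(2)[rule_format] u'(2)[rule_format]], of n n]
      by (simp add: linear_add[OF lin] algebra_simps)
    then show ?thesis unfolding L_def using decreases_to_zero_add[OF u(1) u'(1)] by blast
  qed
  have abs_scale: "\<bar>r *\<^sub>R w\<bar> \<le> \<bar>r\<bar> *\<^sub>R \<bar>w\<bar>" for r and w :: 'a
    using scaleR_left_mono[OF abs_ge_self, of "\<bar>r\<bar>" w] scaleR_left_mono[OF abs_ge_minus_self, of "\<bar>r\<bar>" w]
    by (intro abs_leI; cases "0 \<le> r") auto
  have L_scale: "L (r *\<^sub>R x) (r *\<^sub>R y)" if L: "L x y" for r x y
  proof -
    obtain u where u: "decreases_to_zero u" "\<forall>n. \<bar>?q n x - y\<bar> \<le> u n"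
      using L unfolding L_def by blast
    have "\<bar>?q n (r *\<^sub>R x) - r *\<^sub>R y\<bar> \<le> \<bar>r\<bar> *\<^sub>R u n" for n
      using order_trans[OF abs_scale scaleR_left_mono[OF u(2)[rule_format, of n] abs_ge_zero], of r]
      by (simp add: linear_scale[OF lin] algebra_simps)
    then show ?thesis unfolding L_def using decreases_to_zero_scaleR[OF u(1), of "\<bar>r\<bar>"] by auto
  qed
  have L_pos: "L x (INF n. ?q n x)" if x: "0 \<le> x" for x
  proof -
    have lower: "(INF n. ?q n x) \<le> ?q n x" for n by (rule cINF_lower[OF bdd[OF x] UNIV_I])
    have "decreases_to_zero (\<lambda>n. ?q n x - (INF n. ?q n x))"
    proof (rule decreases_to_zeroI)
      show "decseq (\<lambda>n. ?q n x - (INF n. ?q n x))" using dec[OF x] by (simp add: decseq_def)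
      show "0 \<le> ?q n x - (INF n. ?q n x)" for n using lower by simp
      fix b assume b: "\<And>n. b \<le> ?q n x - (INF n. ?q n x)"
      have "b + (INF n. ?q n x) \<le> (INF n. ?q n x)"
        by (rule cINF_greatest) (use b in \<open>auto simp: algebra_simps\<close>)
      then show "b \<le> 0" by simp
    qed
    then show ?thesis unfolding L_def using lower by (auto simp: abs_of_nonneg)
  qed
  have L_unique: "y = y'" if "L x y" "L x y'" for x y y'
  proof -
    have "L 0 (y - y')" using L_add[OF that(1) L_scale[OF that(2), of "-1"]] by simp
    then obtain u where u: "decreases_to_zero u" "\<forall>n. \<bar>?q n 0 - (y - y')\<bar> \<le> u n"
      unfolding L_def by blast
    have "\<bar>y - y'\<bar> \<le> 0"
      by (rule decreases_to_zero_le[OF u(1)]) (use u(2) in \<open>simp add: linear_0[OF lin] abs_minus_commute\<close>)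
    then show ?thesis by simp
  qed
  have L_ex: "\<exists>y. L x y" for x
  proof -
    obtain p q where pq: "0 \<le> p" "0 \<le> q" "x = p - q" by (rule pprt_plus_neg)
    show ?thesis using L_add[OF L_pos[OF pq(1)] L_scale[OF L_pos[OF pq(2)], of "-1"]] pq(3) by auto
  qed
  \<comment> \<open>By \<open>L_ex\<close> and \<open>L_unique\<close> the order limit is a function
    on the whole lattice, and it inherits linearity from \<open>L\<close>.\<close>
  define f where "f x = (THE y. L x y)" for x
  have f: "L x (f x)" for x unfolding f_def by (rule theI') (use L_ex L_unique in blast)
  have f_eq: "f x = y" if "L x y" for x y using L_unique[OF f that] .
  have f_pos: "f x = (INF n. ?q n x)" if "0 \<le> x" for x using f_eq[OF L_pos[OF that]] .
  have "linear f" by (rule linearI) (auto intro!: f_eq L_add L_scale f)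
  moreover have f_nn: "0 \<le> f x" if "0 \<le> x" for x
    unfolding f_pos[OF that] by (rule cINF_greatest) (use pos that in auto)
  ultimately have "positive_operator f" by (simp add: positive_operator_def)
  moreover have "positive_operator (\<lambda>x. 0 :: 'a)" by (simp add: positive_operator_def module_hom_zero)
  ultimately have rep: "rapply (Abs_regular_operator f) = f"
    by (intro Abs_regular_operator_inverse CollectI exI[of _ f] exI[of _ "\<lambda>x. 0"]) auto
  have f_le: "Abs_regular_operator f \<le> center_op (Q n)" for n
    unfolding less_eq_regular_operator_def rep
    using f_pos by (auto intro: cINF_lower[OF bdd UNIV_I])
  \<comment> \<open>The limit lies between \<open>0\<close> and \<open>center_op (Q 0)\<close>, so
    convexity puts it in the centre. There it is a lower bound of \<open>Q\<close>, hence at most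
    the infimum \<open>0\<close>.\<close>
  have "0 \<le> Abs_regular_operator f" unfolding less_eq_regular_operator_def rep using f_nn by simp
  then have "\<exists>l\<ge>0. \<bar>Abs_regular_operator f\<bar> \<le> l *\<^sub>R 1"
    by (intro center_convex[OF _ _ _ f_le[of 0], of 0]) (use center_op[of "Q 0"] in auto)
  then have c: "center_op (Abs_center (Abs_regular_operator f)) = Abs_regular_operator f"
    by (simp add: Abs_center_inverse)
  have "Abs_center (Abs_regular_operator f) \<le> 0"
    by (rule decreases_to_zero_le[OF Q]) (simp add: less_eq_center.rep_eq c f_le)
  then have f0: "f x \<le> 0"
    using x by (simp add: less_eq_center.rep_eq c zero_center.rep_eq less_eq_regular_operator_def rep)
  show ?thesis
  proof (rule decreases_to_zeroI)
    show "b \<le> 0" if "\<And>n. b \<le> ?q n x" for b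
      using cINF_greatest[of UNIV b "\<lambda>n. ?q n x"] that f0 f_pos[OF x] by (simp add: order_trans)
  qed (use dec pos x in auto)
qed

section \<open>Order integrals\<close>

lemma lattice_measure_nonneg: "lattice_measure M \<mu> \<Longrightarrow> A \<in> sets M \<Longrightarrow> 0 \<le> \<mu> A"
  by (simp add: lattice_measure_def)

text \<open>Countable additivity is applied to \<open>A\<close>, \<open>B\<close> and then empty
  sets. The partial sum up to index \<open>0\<close> is \<open>\<mu> A\<close> alone; from index
  \<open>1\<close> on the partial sums are constant.\<close>

lemma lattice_measure_Un:
  fixes \<mu> :: "'b set \<Rightarrow> 'f::dedekind_complete_vector_lattice"
  assumes \<mu>: "lattice_measure M \<mu>" and AB: "A \<in> sets M" "B \<in> sets M" "A \<inter> B = {}"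
  shows "\<mu> (A \<union> B) = \<mu> A + \<mu> B"
proof -
  define D where "D n = (if n = 0 then A else if n = 1 then B else {})" for n :: nat
  have "range D \<subseteq> sets M" "disjoint_family D" "(\<Union>n. D n) = A \<union> B"
    using AB by (auto simp: D_def disjoint_family_on_def split: if_splits)
  then have *: "bdd_above (range (\<lambda>N. \<Sum>n\<le>N. \<mu> (D n)))" "\<mu> (A \<union> B) = (SUP N. \<Sum>n\<le>N. \<mu> (D n))"
    using \<mu> unfolding lattice_measure_def by metis+
  have \<mu>0: "\<mu> {} = 0" using \<mu> by (simp add: lattice_measure_def)
  have sum: "(\<Sum>n\<le>Suc N. \<mu> (D n)) = \<mu> A + \<mu> B" for N
    by (induction N) (auto simp: D_def \<mu>0)
  have le: "(\<Sum>n\<le>N. \<mu> (D n)) \<le> \<mu> A + \<mu> B" for N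
    using sum lattice_measure_nonneg[OF \<mu> AB(2)] by (cases N) (auto simp: D_def)
  show ?thesis unfolding *(2)
  proof (rule antisym)
    show "(SUP N. \<Sum>n\<le>N. \<mu> (D n)) \<le> \<mu> A + \<mu> B" using le by (intro cSUP_least) auto
    show "\<mu> A + \<mu> B \<le> (SUP N. \<Sum>n\<le>N. \<mu> (D n))"
      using cSUP_upper[OF UNIV_I *(1), of "Suc 0"] by (simp only: sum)
  qed
qed

lemma lattice_measure_UN:
  fixes \<mu> :: "'b set \<Rightarrow> 'f::dedekind_complete_vector_lattice"
  assumes \<mu>: "lattice_measure M \<mu>" and "finite I" "\<And>i. i \<in> I \<Longrightarrow> A i \<in> sets M"
    and "disjoint_family_on A I"
  shows "\<mu> (\<Union>i\<in>I. A i) = (\<Sum>i\<in>I. \<mu> (A i))"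
  using assms(2-)
proof (induction I)
  case empty
  then show ?case using \<mu> by (simp add: lattice_measure_def)
next
  case (insert i I)
  have "(\<Union>i\<in>I. A i) \<in> sets M" using insert.prems(1) insert.hyps by (intro sets.finite_UN) auto
  moreover have "A i \<inter> (\<Union>i\<in>I. A i) = {}" using insert.prems(2) insert.hyps by (auto simp: disjoint_family_on_def)
  ultimately show ?case
    using insert lattice_measure_Un[OF \<mu>, of "A i" "\<Union>i\<in>I. A i"]
    by (auto simp: disjoint_family_on_def)
qed

section \<open>Approximating integrals by sums over finitely many points\<close>

lemma lattice_measure_finite_split:
  fixes \<mu> :: "'b set \<Rightarrow> 'f::dedekind_complete_vector_lattice"
  assumes \<mu>: "lattice_measure M \<mu>" and F: "finite F" "\<And>x. x \<in> F \<Longrightarrow> {x} \<in> sets M"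
    and A: "A \<in> sets M"
  shows "\<mu> A = (\<Sum>x\<in>F \<inter> A. \<mu> {x}) + \<mu> (A - F)"
proof -
  have fs: "F \<in> sets M" using sets.finite_UN[OF F(1), of "\<lambda>x. {x}" M] F(2) by simp
  have "\<mu> A = \<mu> (F \<inter> A \<union> (A - F))" by (rule arg_cong[of _ _ \<mu>]) auto
  also have "\<dots> = \<mu> (F \<inter> A) + \<mu> (A - F)"
    by (rule lattice_measure_Un[OF \<mu>]) (use fs A in auto)
  also have "\<mu> (F \<inter> A) = (\<Sum>x\<in>F \<inter> A. \<mu> {x})"
    using lattice_measure_UN[OF \<mu>, of "F \<inter> A" "\<lambda>x. {x}"] F by (auto simp: disjoint_family_on_def)
  finally show ?thesis .
qed

text \<open>Each level set splits into its points in \<open>F\<close> and the rest. The points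
  regroup to the sum over \<open>F\<close>. The rests partition \<open>space M - F\<close> and carry
  weights between \<open>0\<close> and \<open>C\<close>, which bounds their contribution on both
  sides.\<close>

lemma simple_order_integral_bounds:
  fixes \<mu> :: "'b set \<Rightarrow> 'f::dedekind_complete_vector_lattice"
  assumes \<mu>: "lattice_measure M \<mu>" and F: "finite F" "\<And>x. x \<in> F \<Longrightarrow> {x} \<in> sets M"
    and \<phi>: "simple_function M \<phi>" "\<And>x. x \<in> space M \<Longrightarrow> 0 \<le> \<phi> x" "\<And>x. x \<in> space M \<Longrightarrow> \<phi> x \<le> C"
  shows "(\<Sum>x\<in>F. \<phi> x *\<^sub>R \<mu> {x}) \<le> simple_order_integral M \<mu> \<phi>"
    and "simple_order_integral M \<mu> \<phi> \<le> (\<Sum>x\<in>F. \<phi> x *\<^sub>R \<mu> {x}) + C *\<^sub>R \<mu> (space M - F)"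
proof -
  define A where "A r = \<phi> -` {r} \<inter> space M" for r
  define R where "R = \<phi> ` space M"
  have R: "finite R" "\<And>r. r \<in> R \<Longrightarrow> 0 \<le> r" "\<And>r. r \<in> R \<Longrightarrow> r \<le> C"
    using \<phi> by (auto simp: R_def simple_function_def)
  have A: "A r \<in> sets M" for r using \<phi>(1) by (simp add: A_def simple_functionD)
  have fs: "F \<in> sets M" using sets.finite_UN[OF F(1), of "\<lambda>x. {x}" M] F(2) by simp
  have F_sp: "x \<in> F \<Longrightarrow> x \<in> space M" for x using fs sets.sets_into_space by blast
  have nn: "0 \<le> \<mu> (A r - F)" for r using lattice_measure_nonneg[OF \<mu>] A fs by auto
  have "simple_order_integral M \<mu> \<phi> = (\<Sum>r\<in>R. r *\<^sub>R (\<Sum>x\<in>F \<inter> A r. \<mu> {x})) + (\<Sum>r\<in>R. r *\<^sub>R \<mu> (A r - F))"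
    unfolding simple_order_integral_def R_def[symmetric] A_def[symmetric]
    by (subst lattice_measure_finite_split[OF \<mu> F A]) (auto simp: scaleR_add_right sum.distrib)
  also have "(\<Sum>r\<in>R. r *\<^sub>R (\<Sum>x\<in>F \<inter> A r. \<mu> {x})) = (\<Sum>r\<in>R. \<Sum>x | x \<in> F \<and> \<phi> x = r. \<phi> x *\<^sub>R \<mu> {x})"
    by (auto simp: scaleR_sum_right A_def F_sp intro!: sum.cong)
  also have "\<dots> = (\<Sum>x\<in>F. \<phi> x *\<^sub>R \<mu> {x})"
    by (rule sum.group) (use F R F_sp in \<open>auto simp: R_def\<close>)
  finally have eq: "simple_order_integral M \<mu> \<phi> = (\<Sum>x\<in>F. \<phi> x *\<^sub>R \<mu> {x}) + (\<Sum>r\<in>R. r *\<^sub>R \<mu> (A r - F))" .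
  have "0 \<le> (\<Sum>r\<in>R. r *\<^sub>R \<mu> (A r - F))" by (intro sum_nonneg scaleR_nonneg_nonneg R nn)
  then show "(\<Sum>x\<in>F. \<phi> x *\<^sub>R \<mu> {x}) \<le> simple_order_integral M \<mu> \<phi>" unfolding eq by simp
  have "(\<Sum>r\<in>R. r *\<^sub>R \<mu> (A r - F)) \<le> (\<Sum>r\<in>R. C *\<^sub>R \<mu> (A r - F))"
    by (intro sum_mono scaleR_right_mono R nn)
  also have "\<dots> = C *\<^sub>R \<mu> (\<Union>r\<in>R. A r - F)"
    by (subst lattice_measure_UN[OF \<mu> R(1)])
      (use A fs in \<open>auto simp: scaleR_sum_right disjoint_family_on_def A_def\<close>)
  also have "(\<Union>r\<in>R. A r - F) = space M - F" by (auto simp: A_def R_def)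
  finally show "simple_order_integral M \<mu> \<phi> \<le> (\<Sum>x\<in>F. \<phi> x *\<^sub>R \<mu> {x}) + C *\<^sub>R \<mu> (space M - F)"
    unfolding eq by simp
qed

text \<open>The upper bound passes to the supremum at once. For the lower one, convergence to
  \<open>f\<close> is uniform on the finite set \<open>F\<close>; this leaves an error
  \<open>e\<close> times the sum of the \<open>\<mu> {x}\<close>, which
  \<open>archimedean_le_zero\<close> removes.\<close>

lemma nonneg_order_integral_bounds:
  fixes \<mu> :: "'b set \<Rightarrow> 'f::dedekind_complete_vector_lattice"
  assumes \<mu>: "lattice_measure M \<mu>" and F: "finite F" "\<And>x. x \<in> F \<Longrightarrow> {x} \<in> sets M"
    and f: "f \<in> borel_measurable M" "\<And>x. 0 \<le> f x" "\<And>x. x \<in> space M \<Longrightarrow> f x \<le> C"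
  shows "(\<Sum>x\<in>F. f x *\<^sub>R \<mu> {x}) \<le> nonneg_order_integral M \<mu> f"
    and "nonneg_order_integral M \<mu> f \<le> (\<Sum>x\<in>F. f x *\<^sub>R \<mu> {x}) + C *\<^sub>R \<mu> (space M - F)"
proof -
  \<comment> \<open>\<open>P\<close> is the condition under \<open>SOME\<close> in
    \<open>nonneg_order_integral\<close>. Once \<open>g\<close> shows that some sequence satisfies
    it, the bounds are derived for whichever one is chosen.\<close>
  define P where "P \<phi> \<longleftrightarrow> (\<forall>n. simple_function M (\<phi> n)) \<and>
        (\<forall>x\<in>space M. (\<forall>n. 0 \<le> \<phi> n x) \<and> incseq (\<lambda>n. \<phi> n x) \<and> (\<lambda>n. \<phi> n x) \<longlonglongrightarrow> f x)"
    for \<phi> :: "nat \<Rightarrow> 'b \<Rightarrow> real"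
  define \<phi> where "\<phi> = (SOME \<phi>. P \<phi>)"
  obtain g where g: "incseq g" "\<And>i. simple_function M (g i)" "\<And>x. bdd_above (range (\<lambda>i. g i x))"
     "\<And>i x. 0 \<le> g i x" "f = (SUP i. g i)"
    using borel_measurable_implies_simple_function_sequence_real[OF f(1,2)] by auto
  have "(\<lambda>n. g n x) \<longlonglongrightarrow> f x" for x
    using LIMSEQ_incseq_SUP[OF g(3)] g(1) unfolding g(5) by (simp add: incseq_def le_fun_def image_image)
  then have "P g" using g by (auto simp: P_def incseq_def le_fun_def)
  then have "P \<phi>" unfolding \<phi>_def by (rule someI[of P])
  then have \<phi>: "\<And>n. simple_function M (\<phi> n)" "\<And>n x. x \<in> space M \<Longrightarrow> 0 \<le> \<phi> n x"
    "\<And>x. x \<in> space M \<Longrightarrow> incseq (\<lambda>n. \<phi> n x)" "\<And>x. x \<in> space M \<Longrightarrow> (\<lambda>n. \<phi> n x) \<longlonglongrightarrow> f x"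
    by (auto simp: P_def)
  define J where "J n = simple_order_integral M \<mu> (\<phi> n)" for n
  have int: "nonneg_order_integral M \<mu> f = (SUP n. J n)"
    unfolding nonneg_order_integral_def J_def \<phi>_def P_def Let_def ..
  have \<phi>_le: "\<phi> n x \<le> f x" if "x \<in> space M" for n x using incseq_le[OF \<phi>(3,4)[OF that]] .
  have F_sp: "x \<in> F \<Longrightarrow> x \<in> space M" for x using F(2) sets.sets_into_space by blast
  have nn: "0 \<le> \<mu> {x}" if "x \<in> F" for x using lattice_measure_nonneg[OF \<mu> F(2)[OF that]] .
  have bounds: "(\<Sum>x\<in>F. \<phi> n x *\<^sub>R \<mu> {x}) \<le> J n" "J n \<le> (\<Sum>x\<in>F. \<phi> n x *\<^sub>R \<mu> {x}) + C *\<^sub>R \<mu> (space M - F)" for n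
    using simple_order_integral_bounds[OF \<mu> F \<phi>(1)[of n] \<phi>(2)[of _ n] order_trans[OF \<phi>_le f(3)]]
    unfolding J_def by auto
  have le: "J n \<le> (\<Sum>x\<in>F. f x *\<^sub>R \<mu> {x}) + C *\<^sub>R \<mu> (space M - F)" for n
    by (rule order_trans[OF bounds(2)])
      (intro add_right_mono sum_mono scaleR_right_mono \<phi>_le F_sp nn; assumption)
  then show "nonneg_order_integral M \<mu> f \<le> (\<Sum>x\<in>F. f x *\<^sub>R \<mu> {x}) + C *\<^sub>R \<mu> (space M - F)"
    unfolding int by (intro cSUP_least) auto
  have bdd: "bdd_above (range J)" using le by (rule bdd_aboveI2)
  have "(\<Sum>x\<in>F. f x *\<^sub>R \<mu> {x}) - (SUP n. J n) \<le> 0"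
  proof (rule archimedean_le_zero)
    show "0 \<le> (\<Sum>x\<in>F. \<mu> {x})" using nn by (rule sum_nonneg)
    fix e :: real assume "0 < e"
    have "\<forall>\<^sub>F n in sequentially. \<forall>x\<in>F. dist (\<phi> n x) (f x) < e"
      using F(1) by (rule eventually_ball_finite) (use \<phi>(4) F_sp \<open>0 < e\<close> in \<open>auto intro: tendstoD\<close>)
    then obtain n where n: "\<And>x. x \<in> F \<Longrightarrow> dist (\<phi> n x) (f x) < e"
      by (auto simp: eventually_sequentially)
    have fle: "f x \<le> e + \<phi> n x" if "x \<in> F" for x using n[OF that] by (simp add: dist_real_def)
    have "(\<Sum>x\<in>F. f x *\<^sub>R \<mu> {x}) \<le> (\<Sum>x\<in>F. (e + \<phi> n x) *\<^sub>R \<mu> {x})"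
      by (intro sum_mono scaleR_right_mono fle nn)
    also have "\<dots> = e *\<^sub>R (\<Sum>x\<in>F. \<mu> {x}) + (\<Sum>x\<in>F. \<phi> n x *\<^sub>R \<mu> {x})"
      by (simp add: scaleR_add_left sum.distrib scaleR_sum_right)
    also have "\<dots> \<le> e *\<^sub>R (\<Sum>x\<in>F. \<mu> {x}) + (SUP n. J n)"
      using order_trans[OF bounds(1) cSUP_upper[OF UNIV_I bdd]] by (rule add_left_mono)
    finally show "(\<Sum>x\<in>F. f x *\<^sub>R \<mu> {x}) - (SUP n. J n) \<le> e *\<^sub>R (\<Sum>x\<in>F. \<mu> {x})"
      by (simp add: algebra_simps)
  qed
  then show "(\<Sum>x\<in>F. f x *\<^sub>R \<mu> {x}) \<le> nonneg_order_integral M \<mu> f" unfolding int by simp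
qed

text \<open>The errors for the positive and the negative part both lie between \<open>0\<close> and
  \<open>C *\<^sub>R \<mu> (space M - F)\<close>, so their difference is bounded by the same element
  and the constant does not double.\<close>

lemma real_order_integral_approx:
  fixes \<mu> :: "'b set \<Rightarrow> 'f::dedekind_complete_vector_lattice"
  assumes \<mu>: "lattice_measure M \<mu>" and F: "finite F" "\<And>x. x \<in> F \<Longrightarrow> {x} \<in> sets M"
    and f: "f \<in> borel_measurable M" and C: "0 \<le> C" "\<And>x. x \<in> space M \<Longrightarrow> \<bar>f x\<bar> \<le> C"
  shows "\<bar>real_order_integral M \<mu> f - (\<Sum>x\<in>F. f x *\<^sub>R \<mu> {x})\<bar> \<le> C *\<^sub>R \<mu> (space M - F)"
proof -
  define S where "S g = (\<Sum>x\<in>F. g x *\<^sub>R \<mu> {x})" for g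
  define J where "J = nonneg_order_integral M \<mu>"
  let ?p = "\<lambda>x. max (f x) 0" and ?n = "\<lambda>x. max (- f x) 0"
  have mm: "?p \<in> borel_measurable M" "?n \<in> borel_measurable M" using f by measurable
  have CC: "?p x \<le> C" "?n x \<le> C" if "x \<in> space M" for x using C(2)[OF that] C(1) by auto
  have b: "S ?p \<le> J ?p" "J ?p \<le> S ?p + C *\<^sub>R \<mu> (space M - F)"
    "S ?n \<le> J ?n" "J ?n \<le> S ?n + C *\<^sub>R \<mu> (space M - F)"
    unfolding S_def J_def
    using nonneg_order_integral_bounds[OF \<mu> F mm(1) _ CC(1)]
      nonneg_order_integral_bounds[OF \<mu> F mm(2) _ CC(2)] by auto
  have S: "S f = S ?p - S ?n"
    unfolding S_def sum_subtractf[symmetric] by (intro sum.cong) (auto simp: max_def)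
  have "J ?p - J ?n - S f = (J ?p - S ?p) - (J ?n - S ?n)" unfolding S by simp
  moreover have "\<bar>(J ?p - S ?p) - (J ?n - S ?n)\<bar> \<le> C *\<^sub>R \<mu> (space M - F)"
    using diff_mono[OF b(2) b(3)] diff_mono[OF b(4) b(1)] by (intro abs_leI) (simp_all add: algebra_simps)
  ultimately show ?thesis unfolding real_order_integral_def S_def[symmetric] J_def[symmetric] by (simp only:)
qed

section \<open>Bounded operators on the complexification\<close>

lemma norm_abs:
  fixes x :: "'a::dedekind_complete_banach_lattice"
  shows "norm \<bar>x\<bar> = norm x"
  by (rule antisym) (auto intro: norm_mono_abs)

lemma
  fixes z :: "'a::dedekind_complete_banach_lattice complexification"
  shows norm_cRe_le: "norm (cRe z) \<le> norm z"
    and norm_cIm_le: "norm (cIm z) \<le> norm z"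
    and norm_complexification_le: "norm z \<le> norm (cRe z) + norm (cIm z)"
proof -
  have m: "\<bar>modulus z\<bar> = modulus z" using modulus_nonneg by (rule abs_of_nonneg)
  show "norm (cRe z) \<le> norm z" "norm (cIm z) \<le> norm z" unfolding norm_complexification_def
    by (rule norm_mono_abs; simp add: m abs_cRe_le_modulus abs_cIm_le_modulus)+
  have "norm (modulus z) \<le> norm (\<bar>cRe z\<bar> + \<bar>cIm z\<bar>)"
    by (rule norm_mono_abs) (simp add: m modulus_le_abs_add)
  also have "\<dots> \<le> norm (cRe z) + norm (cIm z)"
    using norm_triangle_ineq[of "\<bar>cRe z\<bar>" "\<bar>cIm z\<bar>"] by (simp add: norm_abs)
  finally show "norm z \<le> norm (cRe z) + norm (cIm z)" unfolding norm_complexification_def .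
qed

text \<open>Convergence can be checked on real and imaginary parts by the preceding norm comparison.
  Completeness is what allows the fixed point theorem to be applied in
  \<open>bounded_spectrum\<close>.\<close>

instance complexification :: (dedekind_complete_banach_lattice) banach
proof
  fix X :: "nat \<Rightarrow> 'a complexification"
  assume X: "Cauchy X"
  have "Cauchy (\<lambda>n. cRe (X n))" "Cauchy (\<lambda>n. cIm (X n))"
    using X norm_cRe_le[of "X m - X n" for m n] norm_cIm_le[of "X m - X n" for m n]
    unfolding Cauchy_iff by (auto, (meson le_less_trans)+)
  then obtain a b where ab: "(\<lambda>n. cRe (X n)) \<longlonglongrightarrow> a" "(\<lambda>n. cIm (X n)) \<longlonglongrightarrow> b"
    using Cauchy_convergent_iff convergent_def by metis
  have "(\<lambda>n. norm (cRe (X n) - a) + norm (cIm (X n) - b)) \<longlonglongrightarrow> 0 + 0"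
    using ab by (intro tendsto_add tendsto_norm_zero) (simp_all add: LIM_zero_iff)
  then have "(\<lambda>n. norm (cRe (X n) - a) + norm (cIm (X n) - b)) \<longlonglongrightarrow> 0" by simp
  then have "(\<lambda>n. X n - Cplx a b) \<longlonglongrightarrow> 0"
    by (rule Lim_null_comparison[rotated])
      (use norm_complexification_le[of "X n - Cplx a b" for n] in auto)
  then show "convergent X" unfolding convergent_def using LIM_zero_iff by blast
qed

section \<open>Complex scalars and boundedness of the spectrum\<close>

lemma scaleC_sel [simp]:
  "cRe (c *\<^sub>C z) = Re c *\<^sub>R cRe z - Im c *\<^sub>R cIm z"
  "cIm (c *\<^sub>C z) = Re c *\<^sub>R cIm z + Im c *\<^sub>R cRe z"
  by (simp_all add: scaleC_def)

lemma scaleC_add_right: "c *\<^sub>C (z + w) = c *\<^sub>C z + c *\<^sub>C w"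
  by (rule complexification.expand) (simp add: algebra_simps)

lemma scaleC_diff_right: "c *\<^sub>C (z - w) = c *\<^sub>C z - c *\<^sub>C w"
  by (rule complexification.expand) (simp add: algebra_simps)

lemma scaleC_scaleC: "c *\<^sub>C d *\<^sub>C z = (c * d) *\<^sub>C z"
  by (rule complexification.expand) (simp add: algebra_simps)

lemma scaleC_one [simp]: "1 *\<^sub>C z = z"
  by (rule complexification.expand) simp

lemma scaleC_zero_right [simp]: "c *\<^sub>C 0 = 0"
  by (rule complexification.expand) simp

lemma scaleC_scaleR: "complex_of_real r *\<^sub>C z = r *\<^sub>R z"
  by (rule complexification.expand) simp

lemma scaleC_eq_iff: "c \<noteq> 0 \<Longrightarrow> c *\<^sub>C z = w \<longleftrightarrow> z = inverse c *\<^sub>C w"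
  by (auto simp: scaleC_scaleC)

text \<open>With \<open>c\<close> in polar form of angle \<open>a\<close>, the term of the supremum
  at angle \<open>t\<close> for \<open>c *\<^sub>C z\<close> is \<open>cmod c\<close> times the term
  at angle \<open>t - a\<close> for \<open>z\<close>.\<close>

lemma modulus_scaleC_le:
  fixes z :: "'a::dedekind_complete_vector_lattice complexification"
  shows "modulus (c *\<^sub>C z) \<le> cmod c *\<^sub>R modulus z"
proof (rule modulus_least)
  fix t
  obtain a where a: "Re c = cmod c * cos a" "Im c = cmod c * sin a"
    by (metis Re_rcis Im_rcis rcis_cmod_Arg)
  have "cos t *\<^sub>R cRe (c *\<^sub>C z) + sin t *\<^sub>R cIm (c *\<^sub>C z)
      = (Re c * cos t + Im c * sin t) *\<^sub>R cRe z + (Re c * sin t - Im c * cos t) *\<^sub>R cIm z"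
    by (simp add: algebra_simps)
  also have "\<dots> = cmod c *\<^sub>R (cos (t - a) *\<^sub>R cRe z + sin (t - a) *\<^sub>R cIm z)"
    by (simp add: a cos_diff sin_diff algebra_simps)
  also have "\<dots> \<le> cmod c *\<^sub>R modulus z"
    by (intro scaleR_left_mono modulus_upper) simp
  finally show "cos t *\<^sub>R cRe (c *\<^sub>C z) + sin t *\<^sub>R cIm (c *\<^sub>C z) \<le> cmod c *\<^sub>R modulus z" .
qed

lemma norm_scaleC_le:
  fixes z :: "'a::dedekind_complete_banach_lattice complexification"
  shows "norm (c *\<^sub>C z) \<le> cmod c * norm z"
proof -
  have "norm (modulus (c *\<^sub>C z)) \<le> norm (cmod c *\<^sub>R modulus z)"
    using modulus_scaleC_le[of c z] modulus_nonneg[of z] modulus_nonneg[of "c *\<^sub>C z"]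
    by (intro norm_mono_abs) (simp add: abs_of_nonneg scaleR_nonneg_nonneg)
  then show ?thesis by (simp add: norm_complexification_def)
qed

text \<open>For large \<open>\<bar>l\<bar>\<close> the equation \<open>A v - l v = w\<close> is a fixed point equation
  \<open>v = (A v - w) / l\<close> for a contraction.\<close>

lemma bounded_spectrum:
  fixes A :: "'a::dedekind_complete_banach_lattice complexification \<Rightarrow> 'a complexification"
  assumes A: "bounded_complex_operator A"
  shows "bounded (spectrum A)"
proof -
  interpret bounded_linear A using A by (simp add: bounded_complex_operator_def)
  have A_scale: "A (c *\<^sub>C z) = c *\<^sub>C A z" for c z
    using A by (simp add: bounded_complex_operator_def)
  obtain K where K: "0 < K" "\<And>z. norm (A z) \<le> norm z * K" using pos_bounded by blast
  have "l \<notin> spectrum A" if l: "K < cmod l" for l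
  proof -
    have l0: "l \<noteq> 0" "0 < cmod l" using l K(1) by auto
    have eq_iff: "A v - l *\<^sub>C v = w \<longleftrightarrow> inverse l *\<^sub>C (A v - w) = v" for v w
      using scaleC_eq_iff[OF l0(1), of v "A v - w"] by (auto simp: algebra_simps)
    have ex1: "\<exists>!v. A v - l *\<^sub>C v = w" for w
      unfolding eq_iff
    proof (rule banach_fix_type[of "K / cmod l"])
      have "dist (inverse l *\<^sub>C (A x - w)) (inverse l *\<^sub>C (A y - w)) \<le> K / cmod l * dist x y" for x y
      proof -
        have "inverse l *\<^sub>C (A x - w) - inverse l *\<^sub>C (A y - w) = inverse l *\<^sub>C A (x - y)"
          by (simp add: diff flip: scaleC_diff_right)
        then have "dist (inverse l *\<^sub>C (A x - w)) (inverse l *\<^sub>C (A y - w)) \<le> cmod (inverse l) * norm (A (x - y))"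
          unfolding dist_norm using norm_scaleC_le by metis
        also have "\<dots> \<le> cmod (inverse l) * (norm (x - y) * K)"
          by (intro mult_left_mono K) simp
        finally show ?thesis using l0(2) by (simp add: dist_norm norm_inverse norm_divide field_simps)
      qed
      then show "\<forall>x y. dist (inverse l *\<^sub>C (A x - w)) (inverse l *\<^sub>C (A y - w)) \<le> K / cmod l * dist x y"
        by blast
    qed (use l K l0 in auto)
    \<comment> \<open>\<open>B\<close> is the resolvent: unique solvability makes it a two-sided
      inverse that is linear over the complex scalars.\<close>
    define B where "B w = (THE v. A v - l *\<^sub>C v = w)" for w
    have B: "A (B w) - l *\<^sub>C B w = w" for w unfolding B_def by (rule theI') (rule ex1)
    have B_eq: "B w = v" if "A v - l *\<^sub>C v = w" for v w using ex1 B that by blast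
    have B_scaleC: "B (c *\<^sub>C w) = c *\<^sub>C B w" for c w
    proof (rule B_eq)
      have "A (c *\<^sub>C B w) - l *\<^sub>C c *\<^sub>C B w = c *\<^sub>C (A (B w) - l *\<^sub>C B w)"
        by (simp add: A_scale scaleC_scaleC scaleC_diff_right mult.commute)
      then show "A (c *\<^sub>C B w) - l *\<^sub>C c *\<^sub>C B w = c *\<^sub>C w" by (simp only: B)
    qed
    have B_add: "B (v + w) = B v + B w" for v w
    proof (rule B_eq)
      have "A (B v + B w) - l *\<^sub>C (B v + B w) = (A (B v) - l *\<^sub>C B v) + (A (B w) - l *\<^sub>C B w)"
        by (simp add: add scaleC_add_right)
      then show "A (B v + B w) - l *\<^sub>C (B v + B w) = v + w" by (simp only: B)
    qed
    \<comment> \<open>Taking norms in the fixed point equation gives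
      \<open>cmod l * norm (B w) \<le> K * norm (B w) + norm w\<close>; solving for
      \<open>norm (B w)\<close> yields the constant.\<close>
    have B_norm: "norm (B w) \<le> norm w * (1 / (cmod l - K))" for w
    proof -
      have "B w = inverse l *\<^sub>C (A (B w) - w)" using B eq_iff by metis
      then have "norm (B w) \<le> cmod (inverse l) * norm (A (B w) - w)" using norm_scaleC_le by metis
      also have "\<dots> \<le> cmod (inverse l) * (norm (B w) * K + norm w)"
        using norm_triangle_ineq4[of "A (B w)" w] K(2)[of "B w"] by (intro mult_left_mono) auto
      finally show ?thesis using l l0 by (simp add: norm_inverse norm_divide field_simps)
    qed
    have "bounded_linear B"
      using B_add B_norm B_scaleC[of "complex_of_real r" for r]
      by (intro bounded_linear_intro[of _ "1 / (cmod l - K)"]) (auto simp: scaleC_scaleR)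
    then have "bounded_complex_operator B" using B_scaleC by (simp add: bounded_complex_operator_def)
    then show ?thesis unfolding spectrum_def using B B_eq by blast
  qed
  then show ?thesis unfolding bounded_iff by (meson not_le)
qed

section \<open>Central operators and their action on vectors\<close>

abbreviation center_apply :: "'a::dedekind_complete_vector_lattice center \<Rightarrow> 'a \<Rightarrow> 'a" where
  "center_apply P \<equiv> rapply (center_op P)"

lemmas center_op_simps [simp] =
  zero_center.rep_eq one_center.rep_eq plus_center.rep_eq minus_center.rep_eq
  uminus_center.rep_eq scaleR_center.rep_eq times_center.rep_eq

lemma center_apply_linear [simp]:
  "center_apply P (x + y) = center_apply P x + center_apply P y"
  "center_apply P (x - y) = center_apply P x - center_apply P y"
  "center_apply P (r *\<^sub>R x) = r *\<^sub>R center_apply P x"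
  "center_apply P 0 = 0"
  by (simp_all add: linear_add linear_diff linear_scale linear_0 linear_rapply)

lemma center_apply_sum: "center_apply (sum P I) x = (\<Sum>i\<in>I. center_apply (P i) x)"
  by (induction I rule: infinite_finite_induct) auto

lemma center_le_iff: "P \<le> Q \<longleftrightarrow> (\<forall>x\<ge>0. center_apply P x \<le> center_apply Q x)"
  by (simp add: less_eq_center.rep_eq less_eq_regular_operator_def)

lemma center_apply_nonneg: "0 \<le> P \<Longrightarrow> 0 \<le> x \<Longrightarrow> 0 \<le> center_apply P x"
  by (simp add: center_le_iff)

lemma center_apply_mono: "0 \<le> P \<Longrightarrow> x \<le> y \<Longrightarrow> center_apply P x \<le> center_apply P y"
  using center_apply_nonneg[of P "y - x"] by simp

lemma abs_center_apply_le:
  assumes "0 \<le> P" shows "\<bar>center_apply P x\<bar> \<le> center_apply P \<bar>x\<bar>"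
  using center_apply_mono[OF assms abs_ge_self, of x] center_apply_mono[OF assms abs_ge_minus_self, of x]
  by (intro abs_leI) (simp_all add: linear_neg[OF linear_rapply])

lemma center_mult_nonneg: "0 \<le> P \<Longrightarrow> 0 \<le> Q \<Longrightarrow> 0 \<le> P * (Q :: _ center)"
  by (simp add: center_le_iff)

text \<open>Both \<open>C *\<^sub>R Q - D\<close> and \<open>C *\<^sub>R Q + D\<close> are positive,
  and so are their products with \<open>P\<close>. When the product of \<open>P\<close> and
  \<open>Q\<close> vanishes, this leaves the product with \<open>D\<close> both nonnegative and
  nonpositive.\<close>

lemma center_mult_eq_zero:
  fixes P Q D :: "'a::dedekind_complete_vector_lattice center"
  assumes D: "\<bar>D\<bar> \<le> C *\<^sub>R Q" and P: "0 \<le> P"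
  shows "P * Q = 0 \<Longrightarrow> P * D = 0" "Q * P = 0 \<Longrightarrow> D * P = 0"
proof -
  have *: "0 \<le> C *\<^sub>R Q - D" "0 \<le> C *\<^sub>R Q + D"
    using abs_le_D1[OF D] abs_le_D2[OF D] by (simp_all add: minus_le_iff[of D] neg_le_iff_le) (metis add.commute diff_0 diff_le_eq)
  show "P * D = 0" if "P * Q = 0"
    using center_mult_nonneg[OF P *(1)] center_mult_nonneg[OF P *(2)] that
    by (intro antisym) (simp_all add: algebra_simps)
  show "D * P = 0" if "Q * P = 0"
    using center_mult_nonneg[OF *(1) P] center_mult_nonneg[OF *(2) P] that
    by (intro antisym) (simp_all add: algebra_simps)
qed

text \<open>At positive vectors this is membership in the centre. In general \<open>x\<close> is
  split into \<open>pprt x\<close> and \<open>- nprt x\<close>, whose sum is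
  \<open>\<bar>x\<bar>\<close>.\<close>

lemma abs_center_apply_bound:
  fixes R :: "'a::dedekind_complete_vector_lattice center"
  obtains l where "0 \<le> l" "\<And>x. \<bar>center_apply R x\<bar> \<le> l *\<^sub>R \<bar>x\<bar>"
proof -
  obtain l where l: "0 \<le> l" "\<bar>center_op R\<bar> \<le> l *\<^sub>R 1" using center_op[of R] by auto
  have pos: "\<bar>center_apply R x\<bar> \<le> l *\<^sub>R x" if "0 \<le> x" for x
    using abs_le_D1[OF l(2)] abs_le_D2[OF l(2)] that
    by (intro abs_leI) (auto simp: less_eq_regular_operator_def)
  have "\<bar>center_apply R x\<bar> \<le> l *\<^sub>R \<bar>x\<bar>" for x
  proof -
    have "\<bar>center_apply R x\<bar> = \<bar>center_apply R (pprt x) - center_apply R (- nprt x)\<bar>"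
      by (subst prts[of x]) (simp flip: center_apply_linear)
    also have "\<dots> \<le> l *\<^sub>R pprt x + l *\<^sub>R (- nprt x)"
      by (rule order_trans[OF abs_triangle_ineq4]) (intro add_mono pos; simp)
    also have "\<dots> = l *\<^sub>R \<bar>x\<bar>" by (simp add: abs_prts scaleR_diff_right)
    finally show ?thesis .
  qed
  with l(1) show ?thesis by (rule that)
qed

lemma capply_sel [simp]:
  "cRe (capply T z) = center_apply (cRe T) (cRe z) - center_apply (cIm T) (cIm z)"
  "cIm (capply T z) = center_apply (cRe T) (cIm z) + center_apply (cIm T) (cRe z)"
  by (simp_all add: capply_def Let_def)

lemma capply_add: "capply T (z + w) = capply T z + capply T w"
  by (rule complexification.expand) (simp add: algebra_simps)

lemma capply_diff: "capply T (z - w) = capply T z - capply T w"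
  by (rule complexification.expand) (simp add: algebra_simps)

lemma capply_scaleC: "capply T (c *\<^sub>C z) = c *\<^sub>C capply T z"
  by (rule complexification.expand) (simp add: algebra_simps)

lemma complexify_sel [simp]: "cRe (complexify x) = x" "cIm (complexify x) = 0"
  by (simp_all add: complexify_def)

lemma one_complexification_sel [simp]: "cRe 1 = 1" "cIm 1 = 0"
  by (simp_all add: one_complexification_def)

lemma bounded_complex_operator_capply:
  fixes T :: "'a::dedekind_complete_banach_lattice center complexification"
  shows "bounded_complex_operator (capply T)"
  unfolding bounded_complex_operator_def
proof (intro conjI allI)
  show "capply T (c *\<^sub>C z) = c *\<^sub>C capply T z" for c z
    by (rule capply_scaleC)
  have norm: "\<exists>l. \<forall>x. norm (center_apply R x) \<le> l * norm x" for R :: "'a center"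
  proof -
    obtain l where l: "0 \<le> l" "\<And>x. \<bar>center_apply R x\<bar> \<le> l *\<^sub>R \<bar>x\<bar>"
      by (rule abs_center_apply_bound[of R]) blast
    have "norm (center_apply R x) \<le> norm (l *\<^sub>R \<bar>x\<bar>)" for x
      using l by (intro norm_mono_abs) (simp add: abs_of_nonneg scaleR_nonneg_nonneg)
    then show ?thesis using l(1) by (auto simp: norm_abs)
  qed
  obtain k l where kl: "\<forall>x. norm (center_apply (cRe T) x) \<le> k * norm x"
     "\<forall>x. norm (center_apply (cIm T) x) \<le> l * norm x" using norm by metis
  \<comment> \<open>The constants \<open>k\<close> and \<open>l\<close> come without a sign, hence
    the maxima with \<open>0\<close>. The factor \<open>2\<close> below adds the bounds for the real
    and imaginary parts.\<close>
  define K where "K = max k 0 + max l 0"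
  have "norm (capply T z) \<le> norm z * (2 * K)" for z
  proof -
    have b: "norm (center_apply (cRe T) x) \<le> max k 0 * norm z"
      "norm (center_apply (cIm T) x) \<le> max l 0 * norm z" if "norm x \<le> norm z" for x
      using kl[rule_format, of x] mult_mono[of k "max k 0" "norm x" "norm z"]
        mult_mono[of l "max l 0" "norm x" "norm z"] that by auto
    have "norm (cRe (capply T z)) \<le> K * norm z" "norm (cIm (capply T z)) \<le> K * norm z"
      using norm_triangle_ineq4[of "center_apply (cRe T) (cRe z)" "center_apply (cIm T) (cIm z)"]
        norm_triangle_ineq[of "center_apply (cRe T) (cIm z)" "center_apply (cIm T) (cRe z)"]
        b[OF norm_cRe_le] b[OF norm_cIm_le]
      by (auto simp: K_def distrib_right)
    then show ?thesis using norm_complexification_le[of "capply T z"] by (simp add: algebra_simps)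
  qed
  then show "bounded_linear (capply T)"
    using capply_scaleC[of T "complex_of_real r" for r]
    by (intro bounded_linear_intro[of _ "2 * K"]) (simp_all add: capply_add scaleC_scaleR)
qed

section \<open>Eigenvector expansions\<close>

lemma complexification_sum_sel:
  "cRe (sum f I) = (\<Sum>i\<in>I. cRe (f i))" "cIm (sum f I) = (\<Sum>i\<in>I. cIm (f i))"
  by (induction I rule: infinite_finite_induct) auto

text \<open>A real operator commutes with forming the rotated combinations whose supremum is the
  modulus, and a positive one is monotone.\<close>

lemma modulus_capply_complexify_le:
  assumes "0 \<le> P"
  shows "modulus (capply (complexify P) z) \<le> center_apply P (modulus z)"
proof (rule modulus_least)
  fix t
  show "cos t *\<^sub>R cRe (capply (complexify P) z) + sin t *\<^sub>R cIm (capply (complexify P) z)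
      \<le> center_apply P (modulus z)"
    using center_apply_mono[OF assms modulus_upper[of t z]] by simp
qed

lemma capply_sum: "capply T (sum z I) = (\<Sum>i\<in>I. capply T (z i))"
  by (induction I rule: infinite_finite_induct) (auto simp: capply_add intro!: complexification.expand)

text \<open>For \<open>0 \<le> P \<le> 1\<close> the operator does not enlarge the modulus of the
  error, so the same dominating sequence serves.\<close>

lemma sigma_order_sums_capply:
  fixes w :: "nat \<Rightarrow> 'a::dedekind_complete_vector_lattice complexification"
  assumes w: "sigma_order_sums w z" and P: "0 \<le> P" "P \<le> 1"
  shows "sigma_order_sums (\<lambda>i. capply (complexify P) (w i)) (capply (complexify P) z)"
proof -
  obtain u where u: "decreases_to_zero u" "\<forall>N. modulus ((\<Sum>i\<le>N. w i) - z) \<le> u N"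
    using w unfolding sigma_order_sums_def sigma_order_convergent_def by blast
  have "modulus ((\<Sum>i\<le>N. capply (complexify P) (w i)) - capply (complexify P) z) \<le> u N" for N
  proof -
    have "modulus (capply (complexify P) ((\<Sum>i\<le>N. w i) - z)) \<le> center_apply P (modulus ((\<Sum>i\<le>N. w i) - z))"
      using P(1) by (rule modulus_capply_complexify_le)
    also have "\<dots> \<le> modulus ((\<Sum>i\<le>N. w i) - z)"
      using P(2) modulus_nonneg[of "(\<Sum>i\<le>N. w i) - z"] by (simp add: center_le_iff)
    also have "\<dots> \<le> u N" using u(2) by blast
    finally show ?thesis by (simp add: capply_diff capply_sum)
  qed
  with u(1) show ?thesis unfolding sigma_order_sums_def sigma_order_convergent_def by blast
qed

text \<open>The partial sums equal \<open>w j\<close> from index \<open>j\<close> on, so the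
  constant error \<open>modulus (w j - z)\<close> lies below a tail of a sequence decreasing to
  zero.\<close>

lemma sigma_order_sums_single_term:
  fixes w :: "nat \<Rightarrow> 'a::dedekind_complete_vector_lattice complexification"
  assumes w: "sigma_order_sums w z" and 0: "\<And>i. i \<noteq> j \<Longrightarrow> w i = 0"
  shows "z = w j"
proof -
  obtain u where u: "decreases_to_zero u" "\<forall>N. modulus ((\<Sum>i\<le>N. w i) - z) \<le> u N"
    using w unfolding sigma_order_sums_def sigma_order_convergent_def by blast
  have "modulus (w j - z) \<le> 0"
  proof (rule decreases_to_zero_eventually_le[OF u(1)])
    fix N assume "j \<le> N"
    then have "(\<Sum>i\<le>N. w i) = w j" using 0 by (subst sum.remove[of _ j]) auto
    then show "modulus (w j - z) \<le> u N" using u(2)[rule_format, of N] by simp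
  qed
  then have "\<bar>cRe (w j - z)\<bar> \<le> 0" "\<bar>cIm (w j - z)\<bar> \<le> 0"
    using abs_cRe_le_modulus abs_cIm_le_modulus order_trans by blast+
  then show ?thesis by (intro complexification.expand) simp
qed

lemma sigma_order_sums_complexify:
  fixes P :: "nat \<Rightarrow> 'a::dedekind_complete_vector_lattice center"
  assumes "decreases_to_zero (\<lambda>N. 1 - (\<Sum>i\<le>N. P i))"
  shows "sigma_order_sums (\<lambda>i. complexify (P i)) 1"
  unfolding sigma_order_sums_def sigma_order_convergent_def
proof (intro exI conjI allI)
  fix N
  have "0 \<le> 1 - (\<Sum>i\<le>N. P i)" using decreases_to_zero_nonneg[OF assms] .
  then show "modulus ((\<Sum>i\<le>N. complexify (P i)) - 1) \<le> 1 - (\<Sum>i\<le>N. P i)"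
    using modulus_le_abs_add[of "(\<Sum>i\<le>N. complexify (P i)) - 1"]
    by (simp add: complexification_sum_sel abs_minus_commute[of _ 1] abs_of_nonneg)
qed (rule assms)

text \<open>The error is the tail operator applied to \<open>- z\<close>. It is dominated by the
  tail at \<open>\<bar>cRe z\<bar>\<close> plus the tail at \<open>\<bar>cIm z\<bar>\<close>, and
  \<open>decreases_to_zero_rapply\<close> carries the infimum from operators over to
  vectors.\<close>

lemma sigma_order_sums_capply_complexify:
  fixes P :: "nat \<Rightarrow> 'a::dedekind_complete_vector_lattice center"
  assumes P: "decreases_to_zero (\<lambda>N. 1 - (\<Sum>i\<le>N. P i))"
  shows "sigma_order_sums (\<lambda>i. capply (complexify (P i)) z) z"
proof -
  define Q where "Q N = 1 - (\<Sum>i\<le>N. P i)" for N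
  have Q: "decreases_to_zero Q" using P unfolding Q_def .
  show ?thesis
    unfolding sigma_order_sums_def sigma_order_convergent_def
  proof (intro exI conjI allI)
    show "decreases_to_zero (\<lambda>N. center_apply (Q N) \<bar>cRe z\<bar> + center_apply (Q N) \<bar>cIm z\<bar>)"
      using Q by (intro decreases_to_zero_add decreases_to_zero_rapply) auto
    fix N
    let ?d = "(\<Sum>i\<le>N. capply (complexify (P i)) z) - z"
    have "cRe ?d = - center_apply (Q N) (cRe z)" "cIm ?d = - center_apply (Q N) (cIm z)"
      by (simp_all add: Q_def complexification_sum_sel center_apply_sum)
    then have "modulus ?d \<le> \<bar>center_apply (Q N) (cRe z)\<bar> + \<bar>center_apply (Q N) (cIm z)\<bar>"
      using modulus_le_abs_add[of ?d] by simp
    also have "\<dots> \<le> center_apply (Q N) \<bar>cRe z\<bar> + center_apply (Q N) \<bar>cIm z\<bar>"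
      by (intro add_mono abs_center_apply_le decreases_to_zero_nonneg[OF Q])
    finally show "modulus ?d \<le> center_apply (Q N) \<bar>cRe z\<bar> + center_apply (Q N) \<bar>cIm z\<bar>" .
  qed
qed

section \<open>Eigenspaces and spectral projections\<close>

lemma capply_eigenspace:
  assumes "cRe T * P = Re l *\<^sub>R P" "cIm T * P = Im l *\<^sub>R P"
  shows "capply (T - l *\<^sub>C 1) (capply (complexify P) z) = 0"
proof -
  have "center_apply (cRe T) (center_apply P x) = Re l *\<^sub>R center_apply P x"
    "center_apply (cIm T) (center_apply P x) = Im l *\<^sub>R center_apply P x" for x
    using arg_cong[OF assms(1), of "\<lambda>S. center_apply S x"] arg_cong[OF assms(2), of "\<lambda>S. center_apply S x"]
    by simp_all
  then show ?thesis by (intro complexification.expand) simp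
qed

text \<open>Applying \<open>P\<close> to the eigenvector equation of \<open>w\<close> turns
  \<open>T\<close> into the scalar \<open>m\<close>, so \<open>m - l\<close> times the image of
  \<open>w\<close> under \<open>P\<close> vanishes.\<close>

lemma capply_eigenspace_disjoint:
  assumes P: "P * cRe T = Re m *\<^sub>R P" "P * cIm T = Im m *\<^sub>R P"
    and w: "capply (T - l *\<^sub>C 1) w = 0" and "m \<noteq> l"
  shows "capply (complexify P) w = 0"
proof -
  have "center_apply P (center_apply (cRe T) x) = Re m *\<^sub>R center_apply P x"
    "center_apply P (center_apply (cIm T) x) = Im m *\<^sub>R center_apply P x" for x
    using arg_cong[OF P(1), of "\<lambda>S. center_apply S x"] arg_cong[OF P(2), of "\<lambda>S. center_apply S x"]
    by simp_all
  then have "capply (complexify P) (capply (T - l *\<^sub>C 1) w) = (m - l) *\<^sub>C capply (complexify P) w"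
    by (intro complexification.expand) (simp add: algebra_simps)
  moreover have "capply (complexify P) 0 = 0" by (rule complexification.expand) simp
  ultimately show ?thesis using scaleC_eq_iff[of "m - l" "capply (complexify P) w" 0] w \<open>m \<noteq> l\<close> by simp
qed

theorem theorem4p18:
  fixes T :: "'a::dedekind_complete_banach_lattice center complexification"
    and lam :: "nat \<Rightarrow> complex"
    and \<mu> :: "complex set \<Rightarrow> 'a center"
  assumes "normal_lattice TYPE('a center)"
    and "bij_betw lam UNIV (spectrum (capply T))"
    and "is_spectral_measure_of \<mu> T"
  shows "sigma_order_sums (\<lambda>i. complexify (\<mu> {lam i})) 1 \<and>
    sigma_order_sums (\<lambda>i. lam i *\<^sub>C complexify (\<mu> {lam i})) T \<and>
    (\<forall>z :: 'a complexification.
      (\<exists>!w. (\<forall>i. capply (T - lam i *\<^sub>C 1) (w i) = 0) \<and> sigma_order_sums w z) \<and>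
      (\<forall>i. capply (T - lam i *\<^sub>C 1) (capply (complexify (\<mu> {lam i})) z) = 0) \<and>
      sigma_order_sums (\<lambda>i. capply (complexify (\<mu> {lam i})) z) z)"
proof -
  define K where "K = spectrum (capply T)"
  define M where "M = restrict_space borel K"
  define P where "P i = \<mu> {lam i}" for i
  define Q where "Q N = 1 - (\<Sum>i\<le>N. P i)" for N
  have inj: "inj lam" and K: "range lam = K" using assms(2) by (auto simp: bij_betw_def K_def)
  \<comment> \<open>Countable sets of complex numbers are Borel, so every subset of \<open>K\<close>
    is measurable and measurability reduces to inclusion.\<close>
  have "countable K" using K by (metis countable_image countableI_type)
  then have sets_M: "A \<in> sets M \<longleftrightarrow> A \<subseteq> K" for A
    unfolding M_def by (auto simp: sets_restrict_space_iff sets.countable countable_subset)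
  have space_M: "space M = K" by (simp add: M_def space_restrict_space)
  have \<mu>: "lattice_measure M \<mu>" and \<mu>_mult: "\<And>A B. A \<subseteq> K \<Longrightarrow> B \<subseteq> K \<Longrightarrow> \<mu> (A \<inter> B) = \<mu> A * \<mu> B"
    and \<mu>_K: "\<mu> K = 1" and T: "T = order_integral M \<mu> (\<lambda>x. x)"
    using assms(3) unfolding is_spectral_measure_of_def spectral_measure_def Let_def K_def M_def[symmetric, unfolded K_def]
    by (auto simp: sets_M[unfolded K_def])
  have \<mu>_empty: "\<mu> {} = 0" using \<mu> by (simp add: lattice_measure_def)
  have lam_K: "lam i \<in> K" for i using K by auto
  have P_nonneg: "0 \<le> P i" for i
    unfolding P_def by (rule lattice_measure_nonneg[OF \<mu>]) (simp add: sets_M lam_K)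
  have sum_lam: "(\<Sum>x\<in>lam ` {..N}. g x) = (\<Sum>i\<le>N. g (lam i))" for N and g :: "complex \<Rightarrow> 'a center"
    using sum.reindex[OF inj_on_subset[OF inj subset_UNIV]] by (simp add: o_def)
  \<comment> \<open>Writing the tail \<open>Q N\<close> as a value of \<open>\<mu>\<close> gives its
    positivity and, by multiplicativity of \<open>\<mu>\<close>, its products with the
    \<open>P i\<close>.\<close>
  have Q_eq: "\<mu> (K - lam ` {..N}) = Q N" for N
  proof -
    have "\<mu> K = (\<Sum>x\<in>lam ` {..N} \<inter> K. \<mu> {x}) + \<mu> (K - lam ` {..N})"
      by (rule lattice_measure_finite_split[OF \<mu>]) (auto simp: sets_M lam_K)
    also have "lam ` {..N} \<inter> K = lam ` {..N}" using lam_K by auto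
    finally show ?thesis by (simp add: Q_def P_def sum_lam \<mu>_K eq_diff_eq add.commute)
  qed
  have Q_nonneg: "0 \<le> Q N" for N
    unfolding Q_eq[symmetric] by (rule lattice_measure_nonneg[OF \<mu>]) (simp add: sets_M)
  have Q: "decreases_to_zero Q"
  proof (rule decreases_to_zeroI)
    show "decseq Q" using P_nonneg by (intro decseq_SucI) (simp add: Q_def)
    \<comment> \<open>A lower bound \<open>b\<close> of the tails makes \<open>1 - b\<close> an
      upper bound of the partial sums, whose supremum is \<open>\<mu> K = 1\<close>.\<close>
    fix b assume b: "\<And>N. b \<le> Q N"
    have "range (\<lambda>i. {lam i}) \<subseteq> sets M" "disjoint_family (\<lambda>i. {lam i})"
      using lam_K inj by (auto simp: sets_M disjoint_family_on_def inj_def)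
    then have "\<mu> (\<Union>i. {lam i}) = (SUP N. \<Sum>i\<le>N. \<mu> {lam i})"
      using \<mu> unfolding lattice_measure_def by blast
    moreover have "(\<Union>i. {lam i}) = K" using K by auto
    ultimately have "1 = (SUP N. \<Sum>i\<le>N. P i)" by (simp add: \<mu>_K P_def)
    also have "\<dots> \<le> 1 - b"
      by (rule cSUP_least) (use b in \<open>simp_all add: Q_def algebra_simps\<close>)
    finally show "b \<le> 0" by simp
  qed (rule Q_nonneg)
  have P_le: "P i \<le> 1" for i
  proof -
    have "P i \<le> (\<Sum>k\<le>i. P k)" using P_nonneg sum_mono2[of "{..i}" "{i}" P] by simp
    also have "\<dots> \<le> 1" using Q_nonneg[of i] by (simp add: Q_def)
    finally show ?thesis .
  qed
  have P_idem: "P i * P i = P i" for i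
    using \<mu>_mult[of "{lam i}" "{lam i}"] lam_K by (simp add: P_def)
  have P_disj: "P i * P k = 0" if "i \<noteq> k" for i k
    using \<mu>_mult[of "{lam i}" "{lam k}"] lam_K that inj by (simp add: P_def \<mu>_empty inj_eq)
  \<comment> \<open>The set measured by \<open>Q i\<close> omits \<open>lam i\<close>, so its
    intersection with that singleton is empty.\<close>
  have PQ: "P i * Q i = 0" "Q i * P i = 0" for i
    using \<mu>_mult[of "{lam i}" "K - lam ` {..i}"] \<mu>_mult[of "K - lam ` {..i}" "{lam i}"] lam_K
    by (simp_all add: P_def \<mu>_empty flip: Q_eq)
  have "bounded K" unfolding K_def by (intro bounded_spectrum bounded_complex_operator_capply)
  then obtain C where C: "0 < C" "\<And>x. x \<in> K \<Longrightarrow> cmod x \<le> C" by (auto simp: bounded_pos)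
  \<comment> \<open>One estimate for every \<open>f\<close> dominated by \<open>cmod\<close> covers
    both \<open>Re\<close> and \<open>Im\<close> with the same \<open>C\<close>, the bound of the
    spectrum.\<close>
  have approx: "\<bar>real_order_integral M \<mu> f - (\<Sum>i\<le>N. f (lam i) *\<^sub>R P i)\<bar> \<le> C *\<^sub>R Q N"
    if "f \<in> borel_measurable borel" "\<And>x. \<bar>f x\<bar> \<le> cmod x" for f N
  proof -
    have "\<bar>real_order_integral M \<mu> f - (\<Sum>x\<in>lam ` {..N}. f x *\<^sub>R \<mu> {x})\<bar> \<le> C *\<^sub>R \<mu> (space M - lam ` {..N})"
    proof (rule real_order_integral_approx[OF \<mu>])
      show "f \<in> borel_measurable M" unfolding M_def using that(1) by (rule measurable_restrict_space1)
      show "\<bar>f x\<bar> \<le> C" if "x \<in> space M" for x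
        using \<open>\<And>x. \<bar>f x\<bar> \<le> cmod x\<close>[of x] C(2)[of x] that space_M by simp
    qed (use C(1) lam_K in \<open>auto simp: sets_M\<close>)
    then show ?thesis by (simp add: sum_lam space_M Q_eq P_def)
  qed
  have T_sel: "cRe T = real_order_integral M \<mu> Re" "cIm T = real_order_integral M \<mu> Im"
    by (simp_all add: T order_integral_def)
  have approx_T: "\<bar>cRe T - (\<Sum>i\<le>N. Re (lam i) *\<^sub>R P i)\<bar> \<le> C *\<^sub>R Q N"
    "\<bar>cIm T - (\<Sum>i\<le>N. Im (lam i) *\<^sub>R P i)\<bar> \<le> C *\<^sub>R Q N" for N
    unfolding T_sel by (rule approx; simp add: abs_Re_le_cmod abs_Im_le_cmod)+
  \<comment> \<open>Take \<open>N = i\<close>, so that the sum contains the \<open>i\<close>-th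
    term: orthogonality reduces its product with \<open>P i\<close> to
    \<open>g i *\<^sub>R P i\<close>, and \<open>PQ\<close> annihilates the error.\<close>
  have eigen: "S * P i = g i *\<^sub>R P i" "P i * S = g i *\<^sub>R P i"
    if "\<And>N. \<bar>S - (\<Sum>i\<le>N. g i *\<^sub>R P i)\<bar> \<le> C *\<^sub>R Q N" for S g i
  proof -
    have "(\<Sum>k\<le>i. g k *\<^sub>R (P k * P i)) = g i *\<^sub>R P i" "(\<Sum>k\<le>i. g k *\<^sub>R (P i * P k)) = g i *\<^sub>R P i"
      by (subst sum.remove[of _ i]; simp add: P_idem P_disj)+
    then show "S * P i = g i *\<^sub>R P i" "P i * S = g i *\<^sub>R P i"
      using center_mult_eq_zero[OF that[of i] P_nonneg[of i]] PQ[of i]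
      by (simp_all add: left_diff_distrib right_diff_distrib sum_distrib_left sum_distrib_right)
  qed
  note eigen_T = eigen[OF approx_T(1)] eigen[OF approx_T(2)]
  have "sigma_order_sums (\<lambda>i. lam i *\<^sub>C complexify (P i)) T"
    unfolding sigma_order_sums_def sigma_order_convergent_def
  proof (intro exI conjI allI)
    \<comment> \<open>One summand bounds the error of the real part, the other that of the imaginary
      part.\<close>
    show "decreases_to_zero (\<lambda>N. C *\<^sub>R Q N + C *\<^sub>R Q N)"
      using Q C(1) by (intro decreases_to_zero_add decreases_to_zero_scaleR) auto
    fix N
    show "modulus ((\<Sum>i\<le>N. lam i *\<^sub>C complexify (P i)) - T) \<le> C *\<^sub>R Q N + C *\<^sub>R Q N"
      by (rule order_trans[OF modulus_le_abs_add], intro add_mono)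
        (use approx_T[of N] in \<open>simp_all add: complexification_sum_sel abs_minus_commute\<close>)
  qed
  moreover have "sigma_order_sums (\<lambda>i. complexify (P i)) 1"
    using Q unfolding Q_def by (rule sigma_order_sums_complexify)
  moreover have expand: "sigma_order_sums (\<lambda>i. capply (complexify (P i)) z) z" for z
    using Q unfolding Q_def by (rule sigma_order_sums_capply_complexify)
  moreover have eigenvector: "capply (T - lam i *\<^sub>C 1) (capply (complexify (P i)) z) = 0" for i z
    using eigen_T by (intro capply_eigenspace)
  moreover have unique: "w = (\<lambda>i. capply (complexify (P i)) z)"
    if w: "\<forall>i. capply (T - lam i *\<^sub>C 1) (w i) = 0" "sigma_order_sums w z" for w z
  proof
    fix j
    have disj: "capply (complexify (P i)) (w k) = 0" if "i \<noteq> k" for i k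
      using eigen_T w(1) that inj by (intro capply_eigenspace_disjoint[of _ T "lam i" "lam k"]) (auto simp: inj_eq)
    \<comment> \<open>Expand the vector \<open>w j\<close> itself by \<open>expand\<close>: every
      projection other than \<open>P j\<close> annihilates it, so a single term remains.\<close>
    have "w j = capply (complexify (P j)) (w j)"
      using expand disj by (rule sigma_order_sums_single_term)
    \<comment> \<open>Now apply \<open>P j\<close> to the given expansion of \<open>z\<close>, where
      it annihilates every \<open>w k\<close> with \<open>k \<noteq> j\<close>.\<close>
    also have "\<dots> = capply (complexify (P j)) z"
      using sigma_order_sums_capply[OF w(2) P_nonneg P_le] disj[OF not_sym]
      by (rule sigma_order_sums_single_term[symmetric])
    finally show "w j = capply (complexify (P j)) z" .
  qed
  moreover have "\<exists>!w. (\<forall>i. capply (T - lam i *\<^sub>C 1) (w i) = 0) \<and> sigma_order_sums w z" for z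
    by (rule ex1I[of _ "\<lambda>i. capply (complexify (P i)) z"])
      (use expand eigenvector unique in blast)+
  ultimately show ?thesis unfolding P_def by blast
qed

end
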